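(* For any $0<\epsilon<\frac12$ there is a constant $C=C(\epsilon)$ such that whenever $n\in\mathbb N$ and $f\in C(S^n)$ satisfies $\omega_2(f;S^n)\le 1-\epsilon$, there is an $(n+1)$-dimensional Banach lattice $X=(\mathbb R^{n+1},\|\cdot\|_X)$ such that $$\left|f(u)-\tfrac12\bigl(\Phi_X(u)-\Phi_{X^*}(u)\bigr)\right|\le C\qquad\text{for all }u\in S^n .$$
   Context: $S^n=\{u\in\mathbb R^{n+1}:u_i\ge0,\ \sum_{i=1}^{n+1}u_i=1\}$, and $C(S^n)$ is the space of continuous real-valued functions on $S^n$. For $f\in C(S^n)$, $\omega_2(f;S^n)=\sup|f(x)-2f(x+h)+f(x+2h)|$, the supremum over all $x,h\in\mathbb R^{n+1}$ with $x,x+h,x+2h\in S^n$. An $(n+1)$-dimensional Banach lattice here is $\mathbb R^{n+1}$ with a norm $\|\cdot\|_X$ such that $|x_i|\le|y_i|$ for all $i$ implies $\|x\|_X\le\|y\|_X$. Its dual lattice $X^*$ is $\mathbb R^{n+1}$ with norm $\|x^*\|_{X^*}=\sup\{|\sum_ix_i^*x_i|:\|x\|_X\le1\}$. The indicator of $X$ is the function on $S^n$ given by $\Phi_X(u)=\sup_{\|x\|_X\le1}\sum_{i=1}^{n+1}u_i\log_2|x_i|$, with the convention $0\log_20=0$ (and a term $u_i\log_2 0$ with $u_i>0$ equal to $-\infty$). *)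

theory Defs
  imports "HOL-Analysis.Analysis" "HOL-Homology.Homology"
begin

text \<open>
  The dimension varies inside the statement, so the space of all real vectors with
  \<open>n + 1\<close> coordinates is the carrier \<open>topspace (Euclidean_space (Suc n))\<close>, that is, the functions
  \<open>nat \<Rightarrow> real\<close> that vanish at all indices above \<open>n\<close>; the coordinates are numbered from \<open>0\<close> to \<open>n\<close>.
  The simplex is \<^const>\<open>standard_simplex\<close>, whose defining conjunct \<open>x i \<le> 1\<close> is redundant.
\<close>

abbreviation rvecs :: "nat \<Rightarrow> (nat \<Rightarrow> real) set"
  where "rvecs n \<equiv> topspace (Euclidean_space (Suc n))"

abbreviation continuous_on_simplex :: "nat \<Rightarrow> ((nat \<Rightarrow> real) \<Rightarrow> real) \<Rightarrow> bool"
  where "continuous_on_simplex n f \<equiv>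
    continuous_map (subtopology (Euclidean_space (Suc n)) (standard_simplex n)) euclideanreal f"

definition omega2 :: "nat \<Rightarrow> ((nat \<Rightarrow> real) \<Rightarrow> real) \<Rightarrow> ereal"
  where "omega2 n f =
    (SUP (x, h) \<in> {(x, h). x \<in> rvecs n \<and> h \<in> rvecs n \<and> x \<in> standard_simplex n \<and>
                    (\<lambda>i. x i + h i) \<in> standard_simplex n \<and>
                    (\<lambda>i. x i + 2 * h i) \<in> standard_simplex n}.
       ereal \<bar>f x - 2 * f (\<lambda>i. x i + h i) + f (\<lambda>i. x i + 2 * h i)\<bar>)"

text \<open>A lattice norm is constrained only on the carrier. Nonnegativity and completeness are
  automatic.\<close>

definition lattice_norm :: "nat \<Rightarrow> ((nat \<Rightarrow> real) \<Rightarrow> real) \<Rightarrow> bool"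
  where "lattice_norm n N \<longleftrightarrow>
    (\<forall>x\<in>rvecs n. N x = 0 \<longleftrightarrow> x = (\<lambda>i. 0)) \<and>
    (\<forall>x\<in>rvecs n. \<forall>c. N (\<lambda>i. c * x i) = \<bar>c\<bar> * N x) \<and>
    (\<forall>x\<in>rvecs n. \<forall>y\<in>rvecs n. N (\<lambda>i. x i + y i) \<le> N x + N y) \<and>
    (\<forall>x\<in>rvecs n. \<forall>y\<in>rvecs n. (\<forall>i\<le>n. \<bar>x i\<bar> \<le> \<bar>y i\<bar>) \<longrightarrow> N x \<le> N y)"

text \<open>For a lattice norm the supremum below is taken over a bounded set, see
  \<open>bdd_above_dual_norm\<close>, and it is again a lattice norm, see \<open>lattice_norm_dual_norm\<close>.\<close>

definition dual_norm :: "nat \<Rightarrow> ((nat \<Rightarrow> real) \<Rightarrow> real) \<Rightarrow> (nat \<Rightarrow> real) \<Rightarrow> real"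
  where "dual_norm n N y = (SUP x\<in>{x \<in> rvecs n. N x \<le> 1}. \<bar>\<Sum>i\<le>n. y i * x i\<bar>)"

text \<open>The library has \<open>log 2 0 = 0\<close>, hence the case distinction. The convention for zero weights is
  the rule \<open>0 * - \<infinity> = 0\<close> of \<^typ>\<open>ereal\<close>.\<close>

definition elog2 :: "real \<Rightarrow> ereal"
  where "elog2 t = (if t = 0 then - \<infinity> else ereal (log 2 t))"

definition lattice_indicator :: "nat \<Rightarrow> ((nat \<Rightarrow> real) \<Rightarrow> real) \<Rightarrow> (nat \<Rightarrow> real) \<Rightarrow> ereal"
  where "lattice_indicator n N u =
    (SUP x\<in>{x \<in> rvecs n. N x \<le> 1}. \<Sum>i\<le>n. ereal (u i) * elog2 \<bar>x i\<bar>)"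

lemma lattice_normD:
  assumes "lattice_norm n N"
  shows lattice_norm_eq_0: "x \<in> rvecs n \<Longrightarrow> N x = 0 \<longleftrightarrow> x = (\<lambda>i. 0)"
    and lattice_norm_scale: "x \<in> rvecs n \<Longrightarrow> N (\<lambda>i. c * x i) = \<bar>c\<bar> * N x"
    and lattice_norm_triangle:
      "x \<in> rvecs n \<Longrightarrow> y \<in> rvecs n \<Longrightarrow> N (\<lambda>i. x i + y i) \<le> N x + N y"
    and lattice_norm_mono:
      "x \<in> rvecs n \<Longrightarrow> y \<in> rvecs n \<Longrightarrow> (\<And>i. i \<le> n \<Longrightarrow> \<bar>x i\<bar> \<le> \<bar>y i\<bar>) \<Longrightarrow> N x \<le> N y"
  using assms unfolding lattice_norm_def by blast+

lemma rvecs_iff: "x \<in> rvecs n \<longleftrightarrow> (\<forall>i>n. x i = 0)"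
  by (auto simp: topspace_Euclidean_space Suc_le_eq)

lemma lattice_norm_nonneg:
  assumes N: "lattice_norm n N" and x: "x \<in> rvecs n"
  shows "0 \<le> N x"
proof -
  have z: "(\<lambda>i. 0) \<in> rvecs n" by (simp add: rvecs_iff)
  have "N (\<lambda>i. 0) \<le> N x" using lattice_norm_mono[OF N z x] by simp
  then show ?thesis using lattice_norm_eq_0[OF N z] by simp
qed

lemma bdd_above_dual_norm:
  assumes N: "lattice_norm n N"
  shows "bdd_above ((\<lambda>x. \<bar>\<Sum>i\<le>n. y i * x i\<bar>) ` {x \<in> rvecs n. N x \<le> 1})"
proof (rule bdd_aboveI2)
  let ?e = "\<lambda>i j. if j = i then 1 else 0 :: real"
  fix x assume "x \<in> {x \<in> rvecs n. N x \<le> 1}"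
  then have x: "x \<in> rvecs n" "N x \<le> 1" by auto
  have "\<bar>y i * x i\<bar> \<le> \<bar>y i\<bar> / N (?e i)" if i: "i \<le> n" for i
  proof -
    have e: "?e i \<in> rvecs n" using i by (auto simp: rvecs_iff)
    have "?e i \<noteq> (\<lambda>j. 0)" by (metis zero_neq_one)
    then have pos: "N (?e i) > 0"
      using lattice_norm_nonneg[OF N e] lattice_norm_eq_0[OF N e] by auto
    have "(\<lambda>j. x i * ?e i j) \<in> rvecs n" using i by (auto simp: rvecs_iff)
    then have "N (\<lambda>j. x i * ?e i j) \<le> N x" by (rule lattice_norm_mono[OF N _ x(1)]) auto
    then have "\<bar>x i\<bar> * N (?e i) \<le> 1" using lattice_norm_scale[OF N e, of "x i"] x(2) by simp
    then have "\<bar>x i\<bar> \<le> 1 / N (?e i)" using pos by (simp add: field_simps)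
    then have "\<bar>y i\<bar> * \<bar>x i\<bar> \<le> \<bar>y i\<bar> * (1 / N (?e i))" by (rule mult_left_mono) simp
    then show ?thesis by (simp add: abs_mult)
  qed
  then have "(\<Sum>i\<le>n. \<bar>y i * x i\<bar>) \<le> (\<Sum>i\<le>n. \<bar>y i\<bar> / N (?e i))" by (intro sum_mono) auto
  then show "\<bar>\<Sum>i\<le>n. y i * x i\<bar> \<le> (\<Sum>i\<le>n. \<bar>y i\<bar> / N (?e i))"
    using sum_abs[of "\<lambda>i. y i * x i" "{..n}"] by linarith
qed

lemma lattice_norm_dual_norm:
  assumes N: "lattice_norm n N"
  shows "lattice_norm n (dual_norm n N)"
proof -
  let ?B = "{x \<in> rvecs n. N x \<le> 1}"
  have z: "(\<lambda>i. 0) \<in> rvecs n" by (simp add: rvecs_iff)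
  have zB: "(\<lambda>i. 0) \<in> ?B" using z lattice_norm_eq_0[OF N z] by simp
  then have ne: "?B \<noteq> {}" by blast
  have upper: "\<bar>\<Sum>i\<le>n. y i * x i\<bar> \<le> dual_norm n N y" if "x \<in> ?B" for x y
    unfolding dual_norm_def by (rule cSUP_upper[OF that bdd_above_dual_norm[OF N]])
  have least: "dual_norm n N y \<le> b" if "\<And>x. x \<in> ?B \<Longrightarrow> \<bar>\<Sum>i\<le>n. y i * x i\<bar> \<le> b" for y b
    unfolding dual_norm_def by (rule cSUP_least[OF ne that])
  have nonneg: "0 \<le> dual_norm n N y" for y using upper[OF zB, of y] by simp
  have zero: "dual_norm n N (\<lambda>i. 0) = 0"
    using least[of "\<lambda>i. 0" 0] nonneg[of "\<lambda>i. 0"] by simp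
  have le: "dual_norm n N (\<lambda>i. c * y i) \<le> \<bar>c\<bar> * dual_norm n N y" for c y
  proof (rule least)
    fix x assume x: "x \<in> ?B"
    have "(\<Sum>i\<le>n. c * y i * x i) = c * (\<Sum>i\<le>n. y i * x i)"
      by (simp add: sum_distrib_left mult.assoc)
    then show "\<bar>\<Sum>i\<le>n. c * y i * x i\<bar> \<le> \<bar>c\<bar> * dual_norm n N y"
      using upper[OF x, of y] by (simp add: abs_mult mult_left_mono)
  qed
  have hom: "dual_norm n N (\<lambda>i. c * y i) = \<bar>c\<bar> * dual_norm n N y" for c y
  proof (cases "c = 0")
    case True then show ?thesis using zero by simp
  next
    case False
    have "dual_norm n N (\<lambda>i. inverse c * (c * y i)) \<le> \<bar>inverse c\<bar> * dual_norm n N (\<lambda>i. c * y i)"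
      by (rule le)
    then have "dual_norm n N y \<le> dual_norm n N (\<lambda>i. c * y i) / \<bar>c\<bar>"
      using False by (simp add: mult.assoc[symmetric] divide_inverse mult.commute)
    then have "\<bar>c\<bar> * dual_norm n N y \<le> dual_norm n N (\<lambda>i. c * y i)"
      using False by (simp add: pos_le_divide_eq mult.commute)
    then show ?thesis using le[of c y] by linarith
  qed
  have tri: "dual_norm n N (\<lambda>i. y i + y' i) \<le> dual_norm n N y + dual_norm n N y'" for y y'
  proof (rule least)
    fix x assume x: "x \<in> ?B"
    have "(\<Sum>i\<le>n. (y i + y' i) * x i) = (\<Sum>i\<le>n. y i * x i) + (\<Sum>i\<le>n. y' i * x i)"
      by (simp add: distrib_right sum.distrib)
    then show "\<bar>\<Sum>i\<le>n. (y i + y' i) * x i\<bar> \<le> dual_norm n N y + dual_norm n N y'"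
      using upper[OF x, of y] upper[OF x, of y'] by linarith
  qed
  have mono: "dual_norm n N y \<le> dual_norm n N y'"
    if le: "\<And>i. i \<le> n \<Longrightarrow> \<bar>y i\<bar> \<le> \<bar>y' i\<bar>" for y y'
  proof (rule least)
    fix x assume x: "x \<in> ?B"
    let ?x = "\<lambda>i. sgn (y' i) * \<bar>x i\<bar>"
    have xr: "?x \<in> rvecs n" using x by (auto simp: rvecs_iff)
    have "N ?x \<le> N x"
      by (rule lattice_norm_mono[OF N xr]) (use x in \<open>auto simp: abs_mult sgn_if\<close>)
    then have xB: "?x \<in> ?B" using xr x by auto
    have eq: "y' i * ?x i = \<bar>y' i\<bar> * \<bar>x i\<bar>" for i by (simp add: sgn_if abs_if)
    have "\<bar>\<Sum>i\<le>n. y i * x i\<bar> \<le> (\<Sum>i\<le>n. \<bar>y i\<bar> * \<bar>x i\<bar>)"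
      using sum_abs[of "\<lambda>i. y i * x i" "{..n}"] by (simp add: abs_mult)
    also have "\<dots> \<le> (\<Sum>i\<le>n. \<bar>y' i\<bar> * \<bar>x i\<bar>)"
      by (intro sum_mono mult_right_mono le) auto
    also have "\<dots> = (\<Sum>i\<le>n. y' i * ?x i)" by (simp only: eq)
    also have "\<dots> \<le> dual_norm n N y'" using upper[OF xB, of y'] by linarith
    finally show "\<bar>\<Sum>i\<le>n. y i * x i\<bar> \<le> dual_norm n N y'" .
  qed
  have def: "y = (\<lambda>i. 0)" if y: "y \<in> rvecs n" and d: "dual_norm n N y = 0" for y
  proof (cases "N y = 0")
    case True then show ?thesis using lattice_norm_eq_0[OF N y] by simp
  next
    case False
    then have pos: "N y > 0" using lattice_norm_nonneg[OF N y] by simp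
    let ?x = "\<lambda>i. inverse (N y) * y i"
    have "?x \<in> rvecs n" using y by (auto simp: rvecs_iff)
    then have "?x \<in> ?B" using lattice_norm_scale[OF N y, of "inverse (N y)"] pos by simp
    from upper[OF this, of y] d have "(\<Sum>i\<le>n. y i * ?x i) = 0" by simp
    moreover have "(\<Sum>i\<le>n. y i * ?x i) = inverse (N y) * (\<Sum>i\<le>n. y i * y i)"
      by (simp add: sum_distrib_left mult.left_commute)
    ultimately have "(\<Sum>i\<le>n. y i * y i) = 0" using pos by simp
    then have "\<forall>i\<le>n. y i = 0" by (subst (asm) sum_nonneg_eq_0_iff) auto
    then show ?thesis using y by (auto simp: rvecs_iff fun_eq_iff not_le[symmetric])
  qed
  show ?thesis
    unfolding lattice_norm_def using zero hom tri mono def by blast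
qed

end

theory Submission
  imports Defs
begin

text \<open>
  Write \<open>\<Lambda>(u) = \<Sum> u_i log_2 u_i\<close>. If two functions \<open>g_1\<close> and \<open>g_2\<close> on the simplex are convex up to
  an additive constant and \<open>g_1 + g_2 = \<Lambda>\<close>, then they are, up to a constant, the indicators of a
  lattice and of its dual: this is duality for logarithmically convex balls. Let \<open>B_k\<close> consist of the
  positive vectors \<open>y\<close> with \<open>\<Sum> v_i log_2 y_i \<le> g_k(v)\<close> for all \<open>v\<close> in the simplex. The Gibbs
  variational principle says that the logarithm of \<open>\<Sum> x_i y_i\<close> is the maximum over \<open>v\<close> of
  \<open>\<Sum> v_i log_2 x_i + \<Sum> v_i log_2 y_i - \<Lambda>(v)\<close>, so \<open>x \<in> B_1\<close> and \<open>y \<in> B_2\<close> pair to at most \<open>1\<close>. The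
  norm \<open>sup {\<Sum> |x_i| y_i | y \<in> B_2}\<close> therefore has \<open>B_1\<close> in its unit ball and \<open>B_2\<close> in the dual unit
  ball. This bounds the two indicators from below, because Hahn-Banach provides elements of \<open>B_k\<close>
  whose affine function \<open>v \<mapsto> \<Sum> v_i log_2 y_i\<close> nearly touches \<open>g_k\<close> at a given point; the same
  elements and Gibbs' inequality bound them from above
  (\<open>almost_convex_support\<close>, \<open>lattice_norm_from_supportable\<close>).

  The theorem is the case \<open>g_1 = \<Lambda>/2 + f\<close>, \<open>g_2 = \<Lambda>/2 - f\<close>. Almost convexity of both functions, with a
  constant that does not see the dimension, says that
  \<open>|f(\<Sum> w_i x_i) - \<Sum> w_i f(x_i)| \<le> I/2 + D\<close> for all finite mixtures, where
  \<open>I = \<Sum> w_i \<Lambda>(x_i) - \<Lambda>(\<Sum> w_i x_i)\<close> is the mutual information between the index \<open>i\<close> and the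
  coordinate \<open>j\<close> when \<open>i\<close> is drawn with probability \<open>w_i\<close> and then \<open>j\<close> with probability \<open>x_i(j)\<close>. This is \<open>uniform_info_affine\<close>, the heart of the proof. For a fixed \<open>f\<close> the
  estimate holds with some \<open>D\<close> since \<open>f\<close> is bounded, and the best such \<open>D\<close> bounds itself, by one of
  two arguments for a mixture with mean \<open>p\<close>.

  If almost all of the mass of the \<open>x_i\<close> sits where \<open>x_i(j)\<close> is much larger than \<open>p(j)\<close>, replace the
  mixture by that of the midpoints \<open>(x_i + x_k)/2\<close> with weights \<open>w_i w_k\<close>. This changes the average of
  \<open>f\<close> by at most \<open>(1 - \<epsilon>)/2\<close>, whereas half of the information drops by nearly \<open>1/2\<close>. Hence the
  mixture satisfies the estimate with \<open>D - \<epsilon>/4\<close>.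

  Otherwise a fixed proportion of the mass sits where \<open>x_i(j)\<close> is at most a constant multiple of \<open>p(j)\<close>.
  Repeating the midpoint construction a fixed number of times averages this part so well that nearly all of
  the new points contain a fixed vector \<open>q\<close> of mass bounded away from \<open>0\<close>. The contribution of \<open>q\<close>
  to both sides cancels up to constants, and the estimate is used only on what is left, of total mass
  less than \<open>1\<close>: the mixture satisfies the estimate with \<open>C + (1 - c) D\<close>. Together
  \<open>D \<le> max (D - \<epsilon>/4) (C + (1 - c) D)\<close>, so \<open>D \<le> C/c\<close>.
\<close>

section \<open>Logarithmic inequalities\<close>

definition plogp :: "real \<Rightarrow> real"
  where "plogp t = t * log 2 t"

lemma plogp_0 [simp]: "plogp 0 = 0"
  by (simp add: plogp_def)

lemma inverse_ln2_le: "1 / ln 2 \<le> (2::real)"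
proof -
  have "(1/2::real) \<le> ln 2" using ln2_ge_two_thirds by linarith
  then show ?thesis by (simp add: field_simps)
qed

text \<open>
  The graph of \<open>t log_2 t\<close> lies above its tangent at \<open>m\<close>. Every entropy estimate below comes from this
  inequality or from the corresponding one for the logarithm.
\<close>

lemma plogp_tangent:
  assumes "0 \<le> s" and "0 < m"
  shows "s * log 2 m + (s - m) / ln 2 \<le> plogp s"
proof (cases "s = 0")
  case True
  then show ?thesis using assms by simp
next
  case False
  then have s: "s > 0" using assms by simp
  have "ln m - ln s \<le> (m - s) / s" by (rule ln_diff_le) (use s assms in auto)
  then have "s * ln m + (s - m) \<le> s * ln s" using s by (simp add: field_simps)
  then have "(s * ln m + (s - m)) / ln 2 \<le> (s * ln s) / ln 2" by (rule divide_right_mono) simp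
  then show ?thesis by (simp add: plogp_def log_def add_divide_distrib)
qed

lemma plogp_mono_factor:
  assumes "0 \<le> s" and "s \<le> t"
  shows "s * log 2 s \<le> s * log 2 t"
  using assms by (cases "s = 0") auto

lemma plogp_superadd:
  assumes "0 \<le> s" and "0 \<le> t"
  shows "plogp s + plogp t \<le> plogp (s + t)"
  using plogp_mono_factor[of s "s+t"] plogp_mono_factor[of t "s+t"] assms
  by (simp add: plogp_def algebra_simps)

lemma sum_convex_affine:
  fixes w s :: "'i \<Rightarrow> real"
  assumes "sum w A = 1"
  shows "(\<Sum>i\<in>A. w i * (s i * a + b)) = (\<Sum>i\<in>A. w i * s i) * a + b"
proof -
  have "(\<Sum>i\<in>A. w i * (s i * a + b)) = (\<Sum>i\<in>A. w i * s i * a + w i * b)"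
    by (simp add: algebra_simps)
  also have "\<dots> = (\<Sum>i\<in>A. w i * s i) * a + sum w A * b"
    by (simp only: sum.distrib sum_distrib_right)
  finally show ?thesis using assms by simp
qed

lemma plogp_jensen:
  assumes A: "finite A" "\<And>i. i \<in> A \<Longrightarrow> 0 \<le> w i" "sum w A = 1"
    and s: "\<And>i. i \<in> A \<Longrightarrow> 0 \<le> s i"
  shows "plogp (\<Sum>i\<in>A. w i * s i) \<le> (\<Sum>i\<in>A. w i * plogp (s i))"
proof -
  define m where "m = (\<Sum>i\<in>A. w i * s i)"
  have m0: "0 \<le> m" unfolding m_def by (intro sum_nonneg mult_nonneg_nonneg A s)
  show ?thesis
  proof (cases "m = 0")
    case True
    then have "\<And>i. i \<in> A \<Longrightarrow> w i * s i = 0"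
      unfolding m_def using sum_nonneg_eq_0_iff[of A "\<lambda>i. w i * s i"] A s by auto
    then have "\<And>i. i \<in> A \<Longrightarrow> w i * plogp (s i) = 0" by (auto simp: plogp_def)
    then have "(\<Sum>i\<in>A. w i * plogp (s i)) = 0" by (rule sum.neutral[OF ballI])
    then show ?thesis using True unfolding m_def by simp
  next
    case False
    then have m: "0 < m" using m0 by simp
    have "plogp m = (\<Sum>i\<in>A. w i * (s i * log 2 m + (s i - m) / ln 2))"
    proof -
      have "s i * log 2 m + (s i - m) / ln 2 = s i * (log 2 m + 1 / ln 2) + (- m / ln 2)" for i
        by (simp add: algebra_simps diff_divide_distrib)
      then have "(\<Sum>i\<in>A. w i * (s i * log 2 m + (s i - m) / ln 2))
          = m * (log 2 m + 1 / ln 2) + (- m / ln 2)"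
        by (simp only: sum_convex_affine[OF A(3)] m_def)
      then show ?thesis by (simp add: plogp_def algebra_simps)
    qed
    also have "\<dots> \<le> (\<Sum>i\<in>A. w i * plogp (s i))"
      by (intro sum_mono mult_left_mono plogp_tangent A s m)
    finally show ?thesis by (simp add: m_def)
  qed
qed

lemma log2_jensen:
  assumes A: "finite A" "\<And>i. i \<in> A \<Longrightarrow> 0 \<le> w i" "sum w A = 1"
    and s: "\<And>i. i \<in> A \<Longrightarrow> 0 < s i" and m: "m = (\<Sum>i\<in>A. w i * s i)" "0 < m"
  shows "(\<Sum>i\<in>A. w i * log 2 (s i)) \<le> log 2 m"
proof -
  have "log 2 (s i) \<le> log 2 m + (s i - m) / (m * ln 2)" if "i \<in> A" for i
  proof -
    have "ln (s i) - ln m \<le> (s i - m) / m" by (rule ln_diff_le) (use s that m in auto)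
    then have "(ln (s i) - ln m) / ln 2 \<le> ((s i - m) / m) / ln 2" by (rule divide_right_mono) simp
    moreover have "((s i - m) / m) / ln 2 = (s i - m) / (m * ln 2)" by simp
    ultimately show ?thesis unfolding log_def by (metis diff_divide_distrib diff_le_eq add.commute)
  qed
  then have "(\<Sum>i\<in>A. w i * log 2 (s i)) \<le> (\<Sum>i\<in>A. w i * (log 2 m + (s i - m) / (m * ln 2)))"
    by (intro sum_mono mult_left_mono A)
  also have "\<dots> = (\<Sum>i\<in>A. w i * (s i * (1 / (m * ln 2)) + (log 2 m - 1 / ln 2)))"
    using m(2) by (intro sum.cong refl) (simp add: diff_divide_distrib)
  also have "\<dots> = log 2 m"
    unfolding sum_convex_affine[OF A(3)] m(1)[symmetric] using m(2) by simp
  finally show ?thesis .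
qed

lemma log2_one_plus_le: "0 \<le> z \<Longrightarrow> log 2 (1 + z) \<le> 2 * z"
proof -
  assume z: "0 \<le> z"
  have "ln (1 + z) / ln 2 \<le> z / ln 2"
    by (rule divide_right_mono) (use z ln_add_one_self_le_self in auto)
  also have "\<dots> \<le> 2 * z" using mult_left_mono[OF inverse_ln2_le z] by (simp add: mult.commute)
  finally show ?thesis by (simp add: log_def)
qed

text \<open>
  The factor in front of \<open>z\<close> can be made small at the price of an additive constant, since
  \<open>1 + z = e (1 + z) (1 / e)\<close>.
\<close>

lemma log2_one_plus_le_eta:
  assumes z: "0 \<le> z" and e: "0 < e" "e \<le> 1"
  shows "log 2 (1 + z) \<le> 2 * e * z + 2 / e"
proof -
  have "ln (1 + z) = ln (e * (1 + z)) + ln (1 / e)"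
    using z e by (simp add: ln_mult ln_div)
  also have "\<dots> \<le> (e * (1 + z) - 1) + (1 / e - 1)"
    by (intro add_mono ln_le_minus_one) (use z e in auto)
  also have "\<dots> \<le> e * z + 1 / e" using e by (simp add: algebra_simps)
  finally have "ln (1 + z) / ln 2 \<le> (e * z + 1 / e) / ln 2" by (rule divide_right_mono) simp
  also have "\<dots> \<le> (e * z + 1 / e) * 2"
    using mult_left_mono[OF inverse_ln2_le, of "e * z + 1 / e"] z e by simp
  finally show ?thesis by (simp add: log_def algebra_simps)
qed

text \<open>
  Summed over a mixture, with \<open>s\<close> a coordinate of one of its points and \<open>m\<close> that coordinate of the mean,
  the left-hand side is what the midpoint construction falls short of gaining one full bit. The first
  two terms on the right contribute at most \<open>e / 4\<close>; the last one only sees the mass where \<open>s\<close> is at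
  most a constant multiple of \<open>m\<close>.
\<close>

lemma doubling_loss_le:
  assumes s: "0 \<le> s" and m: "0 \<le> m" and e: "0 < e" "e \<le> 1"
  shows "s * log 2 (1 + m / s) \<le> e / 8 * s + e / 8 * m
           + 32 / e * (if s \<le> 16 / e * m then s else 0)"
proof (cases "s \<le> 16 / e * m")
  case True
  show ?thesis
  proof (cases "s = 0")
    case True then show ?thesis using m e by simp
  next
    case False
    then have s': "s > 0" using s by simp
    have "log 2 (1 + m / s) \<le> 2 * (e/16) * (m / s) + 2 / (e/16)"
      by (rule log2_one_plus_le_eta) (use s m e in auto)
    then have "s * log 2 (1 + m / s) \<le> s * (2 * (e/16) * (m / s) + 2 / (e/16))"
      by (rule mult_left_mono) (use s in auto)
    also have "\<dots> = e / 8 * m + 32 / e * s" using s' by (simp add: field_simps)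
    finally have "s * log 2 (1 + m / s) \<le> e / 8 * m + 32 / e * s" .
    moreover have "0 \<le> e / 8 * s" using s e by simp
    ultimately show ?thesis using True by simp
  qed
next
  case False
  then have s': "s > 16 / e * m" by simp
  moreover have "0 \<le> 16 / e * m" using m e by simp
  ultimately have s0: "s > 0" by linarith
  have "s * log 2 (1 + m / s) \<le> s * (2 * (m / s))"
    by (intro mult_left_mono log2_one_plus_le) (use s m in auto)
  also have "\<dots> = 2 * m" using s0 by simp
  also have "\<dots> \<le> e / 8 * s" using s' e by (simp add: field_simps)
  finally show ?thesis using False m e by (simp add: add_increasing2)
qed

text \<open>
  The function \<open>t log_2 (t / p)\<close> is increasing from \<open>t = p\<close> on, and between \<open>-2 p\<close> and \<open>0\<close> before.
\<close>

lemma rel_plogp_mono: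
  assumes b: "0 \<le> b" "b \<le> y" and p: "0 < p"
  shows "plogp b - b * log 2 p \<le> plogp y - y * log 2 p + 2 * p"
proof -
  have *: "- (2 * p) \<le> plogp t - t * log 2 p" if "0 \<le> t" for t
  proof -
    have "t * log 2 p + (t - p) / ln 2 \<le> plogp t" by (rule plogp_tangent) (use that p in auto)
    moreover have "p / ln 2 \<le> 2 * p" using mult_left_mono[OF inverse_ln2_le, of p] p by simp
    moreover have "0 \<le> t / ln 2" using that by simp
    moreover have "(t - p) / ln 2 = t / ln 2 - p / ln 2" by (rule diff_divide_distrib)
    ultimately show ?thesis by linarith
  qed
  show ?thesis
  proof (cases "b \<le> p")
    case True
    then have "plogp b \<le> b * log 2 p" using plogp_mono_factor[of b p] b by (simp add: plogp_def)
    then show ?thesis using *[of y] b by linarith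
  next
    case False
    then have bp: "p < b" by simp
    have "plogp b - b * log 2 p = b * (log 2 b - log 2 p)" by (simp add: plogp_def algebra_simps)
    also have "\<dots> \<le> y * (log 2 y - log 2 p)"
      by (intro mult_mono) (use b bp p in auto)
    also have "\<dots> = plogp y - y * log 2 p" by (simp add: plogp_def algebra_simps)
    finally show ?thesis using p by simp
  qed
qed

lemma plogp_binary:
  assumes s: "0 \<le> s" and t: "0 \<le> t"
  shows "plogp (s + t) \<le> plogp s + plogp t + (s + t)"
proof -
  have "plogp (\<Sum>i\<in>{0,1::nat}. (1/2) * (if i = 0 then s else t))
     \<le> (\<Sum>i\<in>{0,1::nat}. (1/2) * plogp (if i = 0 then s else t))"
    by (rule plogp_jensen) (use assms in auto)
  then have "plogp ((s + t) / 2) \<le> (plogp s + plogp t) / 2" by (simp add: add_divide_distrib)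
  moreover have "plogp ((s + t) / 2) = plogp (s + t) / 2 - (s + t) / 2"
  proof (cases "s + t = 0")
    case False
    then have "log 2 ((s + t) / 2) = log 2 (s + t) - 1" using assms by (subst log_divide) auto
    then show ?thesis unfolding plogp_def \<open>log 2 ((s + t) / 2) = _\<close> by (simp add: field_simps)
  qed simp
  ultimately have "plogp (s + t) / 2 - (s + t) / 2 \<le> (plogp s + plogp t) / 2" by simp
  then show ?thesis by (simp add: field_simps)
qed

section \<open>The simplex and its cone\<close>

definition mass :: "nat \<Rightarrow> (nat \<Rightarrow> real) \<Rightarrow> real"
  where "mass n v = (\<Sum>j\<le>n. v j)"

definition pos_cone :: "nat \<Rightarrow> (nat \<Rightarrow> real) set"
  where "pos_cone n = {v. (\<forall>j. 0 \<le> v j) \<and> (\<forall>j>n. v j = 0)}"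

text \<open>
  The extension of a function on the simplex to the positive cone that is homogeneous of degree one; it is
  \<open>0\<close> at the origin because \<open>mass\<close> is \<open>0\<close> there. On the cone, convex combinations become sums.
\<close>

definition hom_ext :: "nat \<Rightarrow> ((nat \<Rightarrow> real) \<Rightarrow> real) \<Rightarrow> (nat \<Rightarrow> real) \<Rightarrow> real"
  where "hom_ext n f v = mass n v * f (\<lambda>j. v j / mass n v)"

text \<open>
  On the simplex this is the function \<open>\<Lambda>\<close>, the negative of the Shannon entropy in bits. It is not
  homogeneous, see \<open>hom_ext_negent\<close>.
\<close>

definition negent :: "nat \<Rightarrow> (nat \<Rightarrow> real) \<Rightarrow> real"
  where "negent n v = (\<Sum>j\<le>n. plogp (v j))"

lemma coneD: "v \<in> pos_cone n \<Longrightarrow> 0 \<le> v j" "v \<in> pos_cone n \<Longrightarrow> n < j \<Longrightarrow> v j = 0"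
  by (auto simp: pos_cone_def)

lemma zero_in_cone [simp]: "(\<lambda>j. 0) \<in> pos_cone n"
  by (simp add: pos_cone_def)

lemma mass_nonneg: "v \<in> pos_cone n \<Longrightarrow> 0 \<le> mass n v"
  by (auto simp: mass_def pos_cone_def intro: sum_nonneg)

lemma mass_add: "mass n (\<lambda>j. v j + w j) = mass n v + mass n w"
  by (simp add: mass_def sum.distrib)

lemma mass_scale: "mass n (\<lambda>j. t * v j) = t * mass n v"
  by (simp add: mass_def sum_distrib_left)

lemma mass_zero [simp]: "mass n (\<lambda>j. 0) = 0"
  by (simp add: mass_def)

lemma mass_mono: "(\<And>j. v j \<le> w j) \<Longrightarrow> mass n v \<le> mass n w"
  unfolding mass_def by (rule sum_mono)

lemma mass_sum: "mass n (\<lambda>j. \<Sum>i\<in>A. w i j) = (\<Sum>i\<in>A. mass n (w i))"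
  unfolding mass_def by (rule sum.swap)

lemma mass_mean: "mass n (\<lambda>j. \<Sum>i\<in>A. w i * x i j) = (\<Sum>i\<in>A. w i * mass n (x i))"
  unfolding mass_sum mass_scale ..

lemma cone_add: "v \<in> pos_cone n \<Longrightarrow> w \<in> pos_cone n \<Longrightarrow> (\<lambda>j. v j + w j) \<in> pos_cone n"
  by (auto simp: pos_cone_def)

lemma cone_scale: "v \<in> pos_cone n \<Longrightarrow> 0 \<le> t \<Longrightarrow> (\<lambda>j. t * v j) \<in> pos_cone n"
  by (auto simp: pos_cone_def)

lemma cone_sum: "(\<And>i. i \<in> A \<Longrightarrow> w i \<in> pos_cone n) \<Longrightarrow> (\<lambda>j. \<Sum>i\<in>A. w i j) \<in> pos_cone n"
  by (auto simp: pos_cone_def intro!: sum_nonneg sum.neutral)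

lemma cone_mean:
  "(\<And>i. i \<in> A \<Longrightarrow> 0 \<le> w i \<and> x i \<in> pos_cone n) \<Longrightarrow> (\<lambda>j. \<Sum>i\<in>A. w i * x i j) \<in> pos_cone n"
  by (rule cone_sum) (auto intro: cone_scale)

lemma cone_mass_0: "v \<in> pos_cone n \<Longrightarrow> mass n v = 0 \<Longrightarrow> v = (\<lambda>j. 0)"
proof
  fix j assume v: "v \<in> pos_cone n" "mass n v = 0"
  have "\<forall>i\<in>{..n}. v i = 0"
    using v sum_nonneg_eq_0_iff[of "{..n}" v] by (auto simp: mass_def pos_cone_def)
  then show "v j = 0" using v by (cases "j \<le> n") (auto simp: pos_cone_def)
qed

lemma cone_le_mass: "v \<in> pos_cone n \<Longrightarrow> v j \<le> mass n v"
proof (cases "j \<le> n")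
  case True
  assume "v \<in> pos_cone n"
  then show ?thesis unfolding mass_def using True by (intro member_le_sum) (auto simp: pos_cone_def)
next
  case False
  assume "v \<in> pos_cone n"
  then show ?thesis using False mass_nonneg[of v n] by (simp add: pos_cone_def)
qed

lemma simplex_iff: "x \<in> standard_simplex n \<longleftrightarrow> x \<in> pos_cone n \<and> mass n x = 1"
proof
  assume "x \<in> pos_cone n \<and> mass n x = 1"
  then show "x \<in> standard_simplex n"
    using cone_le_mass[of x n] by (auto simp: standard_simplex_def pos_cone_def mass_def)
qed (auto simp: standard_simplex_def pos_cone_def mass_def)

lemma simplexD:
  assumes "x \<in> standard_simplex n"
  shows simplex_cone: "x \<in> pos_cone n" and simplex_mass: "mass n x = 1"
    and simplex_nonneg: "0 \<le> x j" and simplex_beyond: "n < j \<Longrightarrow> x j = 0"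
  using assms by (auto simp: simplex_iff pos_cone_def)

lemma normalize_in_simplex:
  "v \<in> pos_cone n \<Longrightarrow> mass n v \<noteq> 0 \<Longrightarrow> (\<lambda>j. v j / mass n v) \<in> standard_simplex n"
  using mass_nonneg[of v n] mass_scale[of n "1 / mass n v" v]
  by (auto simp: simplex_iff pos_cone_def)

lemma simplex_mean:
  assumes "sum w A = 1" "\<And>i. i \<in> A \<Longrightarrow> 0 \<le> w i \<and> x i \<in> standard_simplex n"
  shows "(\<lambda>j. \<Sum>i\<in>A. w i * x i j) \<in> standard_simplex n"
proof -
  have "(\<Sum>i\<in>A. w i * mass n (x i)) = sum w A"
    by (rule sum.cong) (use assms simplex_mass in auto)
  then show ?thesis
    unfolding simplex_iff mass_mean using assms by (simp add: cone_mean simplex_cone)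
qed

lemma simplex_segment:
  assumes "x \<in> standard_simplex n" "y \<in> standard_simplex n" "0 \<le> t" "t \<le> 1"
  shows "(\<lambda>j. t * x j + (1 - t) * y j) \<in> standard_simplex n"
  using assms by (auto simp: simplex_iff mass_add mass_scale intro!: cone_add cone_scale)

lemma hom_ext_simplex: "x \<in> standard_simplex n \<Longrightarrow> hom_ext n f x = f x"
  by (simp add: hom_ext_def simplex_mass)

lemma hom_ext_mass_0: "mass n v = 0 \<Longrightarrow> hom_ext n f v = 0"
  by (simp add: hom_ext_def)

lemma hom_ext_scale: "hom_ext n f (\<lambda>j. t * v j) = t * hom_ext n f v"
  by (cases "t = 0") (simp_all add: hom_ext_def mass_scale)

lemma hom_ext_add: "hom_ext n (\<lambda>x. a * f x + b * g x) v = a * hom_ext n f v + b * hom_ext n g v"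
  by (simp add: hom_ext_def algebra_simps)

lemma hom_ext_bound:
  assumes B: "\<And>x. x \<in> standard_simplex n \<Longrightarrow> \<bar>f x\<bar> \<le> B" and v: "v \<in> pos_cone n"
  shows "\<bar>hom_ext n f v\<bar> \<le> B * mass n v"
proof (cases "mass n v = 0")
  case False
  then have "\<bar>f (\<lambda>j. v j / mass n v)\<bar> \<le> B" using B normalize_in_simplex[OF v] by blast
  then show ?thesis using mass_nonneg[OF v] mult_left_mono
    by (fastforce simp: hom_ext_def abs_mult mult.commute)
qed (simp add: hom_ext_mass_0)

lemma hom_ext_negent:
  assumes v: "v \<in> pos_cone n"
  shows "hom_ext n (negent n) v = negent n v - plogp (mass n v)"
proof (cases "mass n v = 0")
  case True
  then show ?thesis using cone_mass_0[OF v] by (simp add: hom_ext_mass_0 negent_def)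
next
  case False
  then have m: "0 < mass n v" using mass_nonneg[OF v] by simp
  have "mass n v * plogp (v j / mass n v) = plogp (v j) - v j * log 2 (mass n v)" for j
    using m coneD(1)[OF v, of j] by (cases "v j = 0") (auto simp: plogp_def log_divide algebra_simps)
  then show ?thesis
    by (simp add: hom_ext_def negent_def sum_distrib_left sum_subtractf plogp_def mass_def
        flip: sum_distrib_right)
qed

lemma negent_nonpos: "x \<in> standard_simplex n \<Longrightarrow> negent n x \<le> 0"
  unfolding negent_def
proof (rule sum_nonpos)
  fix j assume x: "x \<in> standard_simplex n"
  have "x j * log 2 (x j) \<le> x j * log 2 1"
    by (rule plogp_mono_factor) (use x in \<open>auto simp: standard_simplex_def\<close>)
  then show "plogp (x j) \<le> 0" by (simp add: plogp_def)
qed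

lemma negent_lower: "x \<in> standard_simplex n \<Longrightarrow> - (2 * real (Suc n)) \<le> negent n x"
proof -
  assume x: "x \<in> standard_simplex n"
  have "- 2 \<le> plogp (x j)" for j
    using plogp_tangent[of "x j" 1] simplex_nonneg[OF x, of j] inverse_ln2_le
    by (auto simp: diff_divide_distrib add_increasing)
       (smt (verit) divide_nonneg_nonneg ln_gt_zero)
  then have "(\<Sum>j\<le>n. - 2) \<le> negent n x" unfolding negent_def by (intro sum_mono)
  then show ?thesis by simp
qed

section \<open>Quasi-additivity\<close>

definition midpoint_affine :: "nat \<Rightarrow> real \<Rightarrow> ((nat \<Rightarrow> real) \<Rightarrow> real) \<Rightarrow> bool"
  where "midpoint_affine n d f \<longleftrightarrow> (\<forall>x\<in>standard_simplex n. \<forall>y\<in>standard_simplex n.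
    \<bar>f (\<lambda>j. (x j + y j) / 2) - (f x + f y) / 2\<bar> \<le> d)"

lemma midpoint_affine_mono: "midpoint_affine n d f \<Longrightarrow> d \<le> d' \<Longrightarrow> midpoint_affine n d' f"
  unfolding midpoint_affine_def by fastforce

lemma midpoint_affine_uminus:
  assumes "midpoint_affine n d f"
  shows "midpoint_affine n d (\<lambda>u. - f u)"
proof -
  have "\<bar>- m - (- a + - b) / 2\<bar> = \<bar>m - (a + b) / 2\<bar>" for m a b :: real
  proof -
    have "- m - (- a + - b) / 2 = - (m - (a + b) / 2)" by (simp add: field_simps)
    then show ?thesis by (simp only: abs_minus_cancel)
  qed
  then show ?thesis using assms by (simp only: midpoint_affine_def)
qed

text \<open>
  An error bound \<open>S\<close> for all segments improves to \<open>1/2 + S/2\<close>: for \<open>t \<le> 1/2\<close> the point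
  \<open>t x + (1 - t) y\<close> is the midpoint of \<open>y\<close> and of \<open>2 t x + (1 - 2 t) y\<close>. Iterating from the bound that
  \<open>B\<close> gives leads to the fixed point \<open>1\<close>.
\<close>

lemma midpoint_affine_segment:
  assumes mid: "midpoint_affine n (1/2) f"
    and B: "\<And>x. x \<in> standard_simplex n \<Longrightarrow> \<bar>f x\<bar> \<le> B"
    and x: "x \<in> standard_simplex n" and y: "y \<in> standard_simplex n"
    and t: "0 \<le> t" "t \<le> 1"
  shows "\<bar>f (\<lambda>j. t * x j + (1 - t) * y j) - (t * f x + (1 - t) * f y)\<bar> \<le> 1"
proof -
  let ?S = "standard_simplex n"
  let ?e = "\<lambda>t x y. \<bar>f (\<lambda>j. t * x j + (1 - t) * y j) - (t * f x + (1 - t) * f y)\<bar>"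
  have B0: "0 \<le> B" using B[OF x] by linarith
  have iter: "?e t x y \<le> 1 + 2 * B / 2 ^ k"
    if "x \<in> ?S" "y \<in> ?S" "0 \<le> t" "t \<le> 1" for k t x y
    using that
  proof (induction k arbitrary: t x y)
    case 0
    have "\<bar>t * f x + (1 - t) * f y\<bar> \<le> t * B + (1 - t) * B"
      using 0 B[of x] B[of y] by (intro order.trans[OF abs_triangle_ineq] add_mono)
        (auto simp: abs_mult intro!: mult_left_mono)
    moreover have "\<bar>f (\<lambda>j. t * x j + (1 - t) * y j)\<bar> \<le> B"
      by (rule B[OF simplex_segment]) (use 0 in auto)
    ultimately show ?case by (simp add: algebra_simps)
  next
    case (Suc k)
    have half: "?e t x y \<le> 1 + 2 * B / 2 ^ Suc k"
      if xy: "x \<in> ?S" "y \<in> ?S" and t: "0 \<le> t" "t \<le> 1/2" for t x y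
    proof -
      let ?w = "\<lambda>j. 2 * t * x j + (1 - 2 * t) * y j"
      have w: "?w \<in> ?S" by (rule simplex_segment) (use xy t in auto)
      have "(\<lambda>j. t * x j + (1 - t) * y j) = (\<lambda>j. (?w j + y j) / 2)"
        by (auto simp: algebra_simps add_divide_distrib)
      then have "\<bar>f (\<lambda>j. t * x j + (1 - t) * y j) - (f ?w + f y) / 2\<bar> \<le> 1/2"
        using mid w xy by (simp add: midpoint_affine_def)
      moreover have e: "?e (2 * t) x y \<le> 1 + 2 * B / 2 ^ k"
        by (rule Suc.IH) (use xy t in auto)
      moreover have "t * f x + (1 - t) * f y = ((2 * t * f x + (1 - 2 * t) * f y) + f y) / 2"
        by (simp add: field_simps)
      moreover have "\<bar>a - (s + c) / 2\<bar> \<le> 1 + e / 2"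
        if "\<bar>a - (b + c) / 2\<bar> \<le> 1/2" "\<bar>b - s\<bar> \<le> 1 + e" for a b c s e :: real
        using that by argo
      moreover have "1 + 2 * B / 2 ^ Suc k = 1 + (2 * B / 2 ^ k) / 2" by simp
      ultimately show ?thesis by presburger
    qed
    show ?case
    proof (cases "t \<le> 1/2")
      case True
      then show ?thesis using half[of x y t] Suc.prems by simp
    next
      case False
      then show ?thesis using half[of y x "1 - t"] Suc.prems by (simp add: add.commute)
    qed
  qed
  have "(\<lambda>k. 1 + 2 * B / 2 ^ k) \<longlonglongrightarrow> 1 + 0"
    by (intro tendsto_add tendsto_const LIMSEQ_divide_realpow_zero) simp
  then show ?thesis
    using LIMSEQ_le_const[of "\<lambda>k. 1 + 2 * B / 2 ^ k" "1 + 0"] iter[OF x y t] by simp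
qed

lemma quasi_additive:
  assumes mid: "midpoint_affine n (1/2) f"
    and B: "\<And>x. x \<in> standard_simplex n \<Longrightarrow> \<bar>f x\<bar> \<le> B"
    and v: "v \<in> pos_cone n" and w: "w \<in> pos_cone n"
  shows "\<bar>hom_ext n f (\<lambda>j. v j + w j) - (hom_ext n f v + hom_ext n f w)\<bar> \<le> mass n v + mass n w"
proof (cases "mass n v = 0 \<or> mass n w = 0")
  case True
  then show ?thesis
    using cone_mass_0[OF v] cone_mass_0[OF w] mass_nonneg[OF v] mass_nonneg[OF w]
    by (auto simp: hom_ext_mass_0)
next
  case False
  define a b where "a = mass n v" and "b = mass n w"
  have ab: "0 < a" "0 < b" using False mass_nonneg[OF v] mass_nonneg[OF w] by (auto simp: a_def b_def)
  define x y t where "x = (\<lambda>j. v j / a)" and "y = (\<lambda>j. w j / b)" and "t = a / (a + b)"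
  have xy: "x \<in> standard_simplex n" "y \<in> standard_simplex n"
    using normalize_in_simplex[OF v] normalize_in_simplex[OF w] False
    by (auto simp: x_def y_def a_def b_def)
  have t: "0 \<le> t" "t \<le> 1" "1 - t = b / (a + b)" using ab by (auto simp: t_def field_simps)
  have "(\<lambda>j. (v j + w j) / (a + b)) = (\<lambda>j. t * x j + (1 - t) * y j)"
    using ab by (simp add: t(3)) (simp add: t_def x_def y_def add_divide_distrib)
  then have "hom_ext n f (\<lambda>j. v j + w j) = (a + b) * f (\<lambda>j. t * x j + (1 - t) * y j)"
    by (simp add: hom_ext_def mass_add a_def b_def)
  moreover have "hom_ext n f v + hom_ext n f w = (a + b) * (t * f x + (1 - t) * f y)"
    using ab by (simp add: t(3) hom_ext_def x_def y_def flip: a_def b_def)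
      (simp add: t_def distrib_left)
  ultimately have "\<bar>hom_ext n f (\<lambda>j. v j + w j) - (hom_ext n f v + hom_ext n f w)\<bar>
      = (a + b) * \<bar>f (\<lambda>j. t * x j + (1 - t) * y j) - (t * f x + (1 - t) * f y)\<bar>"
    using ab by (simp add: abs_mult flip: right_diff_distrib)
  also have "\<dots> \<le> (a + b) * 1"
    by (intro mult_left_mono midpoint_affine_segment[OF mid B] xy t) (use ab in auto)
  finally show ?thesis by (simp add: a_def b_def)
qed

section \<open>Mixtures and mutual information\<close>

definition mixture :: "nat \<Rightarrow> nat set \<Rightarrow> (nat \<Rightarrow> real) \<Rightarrow> (nat \<Rightarrow> nat \<Rightarrow> real) \<Rightarrow> bool"
  where "mixture n A w x \<longleftrightarrow>
    finite A \<and> (\<forall>i\<in>A. 0 \<le> w i \<and> x i \<in> standard_simplex n) \<and> sum w A = 1"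

definition mean :: "nat set \<Rightarrow> (nat \<Rightarrow> real) \<Rightarrow> (nat \<Rightarrow> nat \<Rightarrow> real) \<Rightarrow> nat \<Rightarrow> real"
  where "mean A w x = (\<lambda>j. \<Sum>i\<in>A. w i * x i j)"

text \<open>
  For a mixture this is the mutual information between the index \<open>i\<close>, drawn with probability \<open>w i\<close>, and the
  coordinate \<open>j\<close>, drawn with probability \<open>x i j\<close> given \<open>i\<close>.
\<close>

definition info :: "nat \<Rightarrow> nat set \<Rightarrow> (nat \<Rightarrow> real) \<Rightarrow> (nat \<Rightarrow> nat \<Rightarrow> real) \<Rightarrow> real"
  where "info n A w x = (\<Sum>i\<in>A. w i * negent n (x i)) - negent n (mean A w x)"

text \<open>
  Applied to \<open>f\<close>, the estimate says that both \<open>\<Lambda>/2 + f\<close> and \<open>\<Lambda>/2 - f\<close> satisfy Jensen's inequality up to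
  the error \<open>D\<close>.
\<close>

definition info_affine :: "nat \<Rightarrow> ((nat \<Rightarrow> real) \<Rightarrow> real) \<Rightarrow> real \<Rightarrow> bool"
  where "info_affine n f D \<longleftrightarrow> (\<forall>A w x. mixture n A w x \<longrightarrow>
    \<bar>f (mean A w x) - (\<Sum>i\<in>A. w i * f (x i))\<bar> \<le> info n A w x / 2 + D)"

lemma mixtureD:
  assumes "mixture n A w x"
  shows mixture_finite: "finite A" and mixture_sum: "sum w A = 1"
    and mixture_weight: "i \<in> A \<Longrightarrow> 0 \<le> w i"
    and mixture_point: "i \<in> A \<Longrightarrow> x i \<in> standard_simplex n"
  using assms by (auto simp: mixture_def)

lemma mean_in_simplex: "mixture n A w x \<Longrightarrow> mean A w x \<in> standard_simplex n"
  unfolding mean_def by (rule simplex_mean) (auto simp: mixture_def)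

lemma mean_nonneg: "(\<And>i. i \<in> A \<Longrightarrow> 0 \<le> w i \<and> 0 \<le> x i j) \<Longrightarrow> 0 \<le> mean A w x j"
  unfolding mean_def by (intro sum_nonneg mult_nonneg_nonneg) auto

lemma info_coords:
  "info n A w x = (\<Sum>j\<le>n. (\<Sum>i\<in>A. w i * plogp (x i j)) - plogp (mean A w x j))"
  unfolding info_def negent_def sum_subtractf sum_distrib_left
  by (subst sum.swap) simp

lemma mixture_coord_jensen:
  assumes "mixture n A w x"
  shows "plogp (mean A w x j) \<le> (\<Sum>i\<in>A. w i * plogp (x i j))"
  unfolding mean_def using assms
  by (intro plogp_jensen) (auto simp: mixture_def standard_simplex_def)

lemma info_nonneg: "mixture n A w x \<Longrightarrow> 0 \<le> info n A w x"
  unfolding info_coords by (intro sum_nonneg) (simp add: mixture_coord_jensen)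

lemma sum_weight_abs_le:
  assumes m: "mixture n A w x" and g: "\<And>i. i \<in> A \<Longrightarrow> \<bar>g i\<bar> \<le> c"
  shows "\<bar>\<Sum>i\<in>A. w i * g i\<bar> \<le> c"
proof -
  have "\<bar>\<Sum>i\<in>A. w i * g i\<bar> \<le> (\<Sum>i\<in>A. w i * c)"
    using m g by (intro order.trans[OF sum_abs] sum_mono)
      (auto simp: abs_mult mixture_def intro!: mult_left_mono)
  also have "\<dots> = c" using mixture_sum[OF m] by (simp flip: sum_distrib_right)
  finally show ?thesis .
qed

lemma info_affine_bounded:
  assumes B: "\<And>x. x \<in> standard_simplex n \<Longrightarrow> \<bar>f x\<bar> \<le> B"
  shows "info_affine n f (2 * B)"
  unfolding info_affine_def
proof (intro allI impI)
  fix A w x assume m: "mixture n A w x"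
  have "\<bar>\<Sum>i\<in>A. w i * f (x i)\<bar> \<le> B"
    by (rule sum_weight_abs_le[OF m]) (use B mixture_point[OF m] in blast)
  then show "\<bar>f (mean A w x) - (\<Sum>i\<in>A. w i * f (x i))\<bar> \<le> info n A w x / 2 + 2 * B"
    using B[OF mean_in_simplex[OF m]] info_nonneg[OF m] by linarith
qed

text \<open>
  The homogeneous form of the estimate. Normalising a family of cone vectors turns it into a mixture
  whose weights are proportional to the masses; vectors of mass \<open>0\<close> are replaced by a vertex with weight \<open>0\<close>.
\<close>

lemma info_affine_sum:
  fixes A :: "nat set"
  assumes D: "info_affine n f D" and A: "finite A" and v: "\<And>i. i \<in> A \<Longrightarrow> v i \<in> pos_cone n"
    and T: "T = (\<lambda>j. \<Sum>i\<in>A. v i j)"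
  shows "\<bar>hom_ext n f T - (\<Sum>i\<in>A. hom_ext n f (v i))\<bar>
    \<le> ((\<Sum>i\<in>A. hom_ext n (negent n) (v i)) - hom_ext n (negent n) T) / 2 + D * mass n T"
proof -
  have mT: "mass n T = (\<Sum>i\<in>A. mass n (v i))" by (simp add: T mass_sum)
  show ?thesis
  proof (cases "mass n T = 0")
    case True
    then have "mass n (v i) = 0" if "i \<in> A" for i
      using that v A sum_nonneg_eq_0_iff[of A "\<lambda>i. mass n (v i)"] mass_nonneg mT by auto
    then show ?thesis using True by (simp add: hom_ext_mass_0)
  next
    case False
    define t where "t = mass n T"
    have t: "0 < t"
      using False mass_nonneg v sum_nonneg[of A "\<lambda>i. mass n (v i)"] mT by (force simp: t_def)
    define e :: "nat \<Rightarrow> real" where "e = (\<lambda>j. if j = 0 then 1 else 0)"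
    define w where "w i = mass n (v i) / t" for i
    define x where "x i = (if mass n (v i) = 0 then e else (\<lambda>j. v i j / mass n (v i)))" for i
    have mix: "mixture n A w x"
      unfolding mixture_def
      using A v t mass_nonneg normalize_in_simplex basis_in_standard_simplex[of 0 n]
      by (auto simp: w_def x_def e_def mT[folded t_def] simp flip: sum_divide_distrib)
    have wx: "t * (w i * g (x i)) = hom_ext n g (v i)" for g i
      using t by (auto simp: w_def x_def hom_ext_def)
    have wxj: "t * (w i * x i j) = v i j" if "i \<in> A" for i j
      using t cone_mass_0[OF v[OF that]] by (auto simp: w_def x_def)
    have "mean A w x j = T j / t" for j
    proof -
      have "t * mean A w x j = (\<Sum>i\<in>A. v i j)"
        unfolding mean_def sum_distrib_left by (rule sum.cong) (auto simp: wxj)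
      then show ?thesis using t by (simp add: T field_simps)
    qed
    then have mean: "t * g (mean A w x) = hom_ext n g T" for g
      by (simp add: hom_ext_def t_def fun_eq_iff[symmetric])
         (metis (no_types, lifting) ext t_def)
    have sums: "t * (\<Sum>i\<in>A. w i * g (x i)) = (\<Sum>i\<in>A. hom_ext n g (v i))" for g
      unfolding sum_distrib_left by (rule sum.cong) (auto simp: wx)
    have "\<bar>f (mean A w x) - (\<Sum>i\<in>A. w i * f (x i))\<bar> \<le> info n A w x / 2 + D"
      using D mix by (simp add: info_affine_def)
    then have "t * \<bar>f (mean A w x) - (\<Sum>i\<in>A. w i * f (x i))\<bar> \<le> t * (info n A w x / 2 + D)"
      using t by (intro mult_left_mono) auto
    moreover have "t * \<bar>f (mean A w x) - (\<Sum>i\<in>A. w i * f (x i))\<bar>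
        = \<bar>t * f (mean A w x) - t * (\<Sum>i\<in>A. w i * f (x i))\<bar>"
      using t by (simp add: abs_mult flip: right_diff_distrib)
    moreover have "t * (info n A w x / 2 + D)
       = (t * (\<Sum>i\<in>A. w i * negent n (x i)) - t * negent n (mean A w x)) / 2 + D * t"
      by (simp add: info_def algebra_simps)
    ultimately show ?thesis unfolding mean sums by (simp add: t_def)
  qed
qed

text \<open>
  With points in the cone instead of the simplex, \<open>info\<close> is at least the total mass times the mutual
  information of the normalised family: by Jensen's inequality for \<open>plogp\<close> the difference, which comes from the
  spread of the masses, has the right sign.
\<close>

lemma info_affine_mean:
  assumes D: "info_affine n f D" and A: "finite A" "\<And>i. i \<in> A \<Longrightarrow> 0 \<le> w i" "sum w A = 1"
    and v: "\<And>i. i \<in> A \<Longrightarrow> v i \<in> pos_cone n"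
  shows "\<bar>hom_ext n f (mean A w v) - (\<Sum>i\<in>A. w i * hom_ext n f (v i))\<bar>
    \<le> info n A w v / 2 + D * mass n (mean A w v)"
proof -
  let ?v = "\<lambda>i j. w i * v i j"
  have c: "?v i \<in> pos_cone n" if "i \<in> A" for i using A v that by (intro cone_scale)
  have mc: "mean A w v \<in> pos_cone n" unfolding mean_def by (rule cone_sum[OF c])
  have "plogp (mass n (mean A w v)) \<le> (\<Sum>i\<in>A. w i * plogp (mass n (v i)))"
    unfolding mean_def mass_mean by (rule plogp_jensen[OF A mass_nonneg[OF v]])
  moreover have "(\<Sum>i\<in>A. hom_ext n (negent n) (?v i))
      = (\<Sum>i\<in>A. w i * negent n (v i)) - (\<Sum>i\<in>A. w i * plogp (mass n (v i)))"
    unfolding sum_subtractf[symmetric] hom_ext_scale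
    by (rule sum.cong) (auto simp: hom_ext_negent[OF v] algebra_simps)
  moreover have "\<bar>hom_ext n f (mean A w v) - (\<Sum>i\<in>A. hom_ext n f (?v i))\<bar>
    \<le> ((\<Sum>i\<in>A. hom_ext n (negent n) (?v i)) - hom_ext n (negent n) (mean A w v)) / 2
        + D * mass n (mean A w v)"
    by (rule info_affine_sum[OF D A(1) c]) (auto simp: mean_def)
  ultimately show ?thesis
    unfolding hom_ext_scale hom_ext_negent[OF mc] info_def by argo
qed

section \<open>Averaging independent copies\<close>

text \<open>
  From a mixture pass to the midpoints of two independently drawn points. Pairs of indices are
  encoded as natural numbers so that the construction can be iterated within one type of mixtures.
\<close>

definition pair_set :: "nat set \<Rightarrow> nat set"
  where "pair_set A = prod_encode ` (A \<times> A)"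

definition pair_weight :: "(nat \<Rightarrow> real) \<Rightarrow> nat \<Rightarrow> real"
  where "pair_weight w k = w (fst (prod_decode k)) * w (snd (prod_decode k))"

definition pair_mid :: "(nat \<Rightarrow> nat \<Rightarrow> real) \<Rightarrow> nat \<Rightarrow> nat \<Rightarrow> real"
  where "pair_mid x k = (\<lambda>j. (x (fst (prod_decode k)) j + x (snd (prod_decode k)) j) / 2)"

lemma finite_pair_set: "finite A \<Longrightarrow> finite (pair_set A)"
  by (simp add: pair_set_def)

lemma pair_setD: "k \<in> pair_set A \<Longrightarrow> fst (prod_decode k) \<in> A \<and> snd (prod_decode k) \<in> A"
  by (auto simp: pair_set_def)

lemma sum_pair:
  "(\<Sum>k\<in>pair_set A. pair_weight w k * g (fst (prod_decode k)) (snd (prod_decode k)))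
    = (\<Sum>i\<in>A. \<Sum>k\<in>A. w i * w k * g i k)"
  unfolding pair_set_def pair_weight_def
  by (subst sum.reindex) (auto simp: inj_prod_encode sum.cartesian_product case_prod_beta)

lemma sum_pair_sym:
  fixes w g :: "nat \<Rightarrow> real"
  assumes "sum w A = 1"
  shows "(\<Sum>i\<in>A. \<Sum>k\<in>A. w i * w k * (g i + g k)) = 2 * (\<Sum>i\<in>A. w i * g i)"
proof -
  have 1: "(\<Sum>i\<in>A. \<Sum>k\<in>A. w i * w k * g i) = (\<Sum>i\<in>A. w i * g i)"
  proof (rule sum.cong)
    fix i
    have "(\<Sum>k\<in>A. w i * w k * g i) = sum w A * (w i * g i)"
      by (simp add: sum_distrib_left sum_distrib_right mult_ac)
    then show "(\<Sum>k\<in>A. w i * w k * g i) = w i * g i" using assms by simp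
  qed simp
  have "(\<Sum>i\<in>A. \<Sum>k\<in>A. w i * w k * g k) = (\<Sum>k\<in>A. \<Sum>i\<in>A. w k * w i * g k)"
    by (subst sum.swap) (simp add: mult_ac)
  then show ?thesis using 1 by (simp add: distrib_left sum.distrib)
qed

lemma sum_pair_1: "sum w A = 1 \<Longrightarrow> sum (pair_weight w) (pair_set A) = 1"
  using sum_pair[of w "\<lambda>_ _. 1" A] sum_pair_sym[of w A "\<lambda>_. 1/2"]
  by (simp flip: sum_divide_distrib)

lemma mean_pair:
  assumes "sum w A = 1"
  shows "mean (pair_set A) (pair_weight w) (pair_mid x) = mean A w x"
proof
  fix j
  show "mean (pair_set A) (pair_weight w) (pair_mid x) j = mean A w x j"
    using sum_pair[of w "\<lambda>i k. (x i j + x k j) / 2" A] sum_pair_sym[OF assms, of "\<lambda>i. x i j"]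
    by (simp add: mean_def pair_mid_def flip: sum_divide_distrib)
qed

lemma mixture_pair:
  assumes m: "mixture n A w x"
  shows "mixture n (pair_set A) (pair_weight w) (pair_mid x)"
  unfolding mixture_def
proof (intro conjI ballI)
  fix k assume "k \<in> pair_set A"
  note k = pair_setD[OF this]
  show "0 \<le> pair_weight w k" using k mixture_weight[OF m] by (simp add: pair_weight_def)
  show "pair_mid x k \<in> standard_simplex n"
    using simplex_segment[OF mixture_point[OF m] mixture_point[OF m], of _ _ "1/2"] k
    by (simp add: pair_mid_def add_divide_distrib)
qed (use m in \<open>auto simp: mixture_def finite_pair_set sum_pair_1\<close>)

lemma pair_average:
  assumes m: "mixture n A w x" and mid: "midpoint_affine n d f"
  shows "\<bar>(\<Sum>k\<in>pair_set A. pair_weight w k * f (pair_mid x k)) - (\<Sum>i\<in>A. w i * f (x i))\<bar> \<le> d"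
proof -
  let ?a = "\<lambda>k. (f (x (fst (prod_decode k))) + f (x (snd (prod_decode k)))) / 2"
  have "(\<Sum>i\<in>A. w i * f (x i)) = (\<Sum>k\<in>pair_set A. pair_weight w k * ?a k)"
    using sum_pair[of w "\<lambda>i k. (f (x i) + f (x k)) / 2" A]
      sum_pair_sym[OF mixture_sum[OF m], of "\<lambda>i. f (x i)"]
    by (simp flip: sum_divide_distrib)
  then have "\<bar>(\<Sum>k\<in>pair_set A. pair_weight w k * f (pair_mid x k)) - (\<Sum>i\<in>A. w i * f (x i))\<bar>
     = \<bar>\<Sum>k\<in>pair_set A. pair_weight w k * (f (pair_mid x k) - ?a k)\<bar>"
    by (simp add: sum_subtractf right_diff_distrib)
  also have "\<dots> \<le> d"
  proof (rule sum_weight_abs_le[OF mixture_pair[OF m]])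
    fix k assume k: "k \<in> pair_set A"
    show "\<bar>f (pair_mid x k) - ?a k\<bar> \<le> d"
      using mid pair_setD[OF k] mixture_point[OF m] by (simp add: midpoint_affine_def pair_mid_def)
  qed
  finally show ?thesis .
qed

lemma info_pair_le:
  assumes m: "mixture n A w x"
  shows "info n (pair_set A) (pair_weight w) (pair_mid x) \<le> info n A w x"
  unfolding info_coords mean_pair[OF mixture_sum[OF m]]
proof (rule sum_mono)
  fix j
  have "(\<Sum>k\<in>pair_set A. pair_weight w k * plogp (pair_mid x k j))
     = (\<Sum>i\<in>A. \<Sum>k\<in>A. w i * w k * plogp ((x i j + x k j) / 2))"
    unfolding pair_mid_def by (rule sum_pair)
  also have "\<dots> \<le> (\<Sum>i\<in>A. \<Sum>k\<in>A. w i * w k * ((plogp (x i j) + plogp (x k j)) / 2))"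
  proof (intro sum_mono mult_left_mono)
    fix i k assume ik: "i \<in> A" "k \<in> A"
    have "plogp (\<Sum>l\<in>{0,1::nat}. (1/2) * (if l = 0 then x i j else x k j))
       \<le> (\<Sum>l\<in>{0,1::nat}. (1/2) * plogp (if l = 0 then x i j else x k j))"
      by (rule plogp_jensen) (use mixture_point[OF m] ik simplex_nonneg in auto)
    then show "plogp ((x i j + x k j) / 2) \<le> (plogp (x i j) + plogp (x k j)) / 2"
      by (simp add: add_divide_distrib)
    show "0 \<le> w i * w k" using ik mixture_weight[OF m] by simp
  qed
  also have "\<dots> = (\<Sum>i\<in>A. w i * plogp (x i j))"
    using sum_pair_sym[OF mixture_sum[OF m], of "\<lambda>i. plogp (x i j)"]
    by (simp flip: sum_divide_distrib)
  finally show "(\<Sum>k\<in>pair_set A. pair_weight w k * plogp (pair_mid x k j)) - plogp (mean A w x j)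
    \<le> (\<Sum>i\<in>A. w i * plogp (x i j)) - plogp (mean A w x j)" by simp
qed

text \<open>
  Write \<open>s\<close> and \<open>s'\<close> for the same coordinate of two independent points. By symmetry the average of
  \<open>plogp ((s + s') / 2)\<close> is that of \<open>s log_2 ((s + s') / 2)\<close>, and by concavity of the logarithm averaging
  over \<open>s'\<close> replaces \<open>s'\<close> by its mean \<open>m\<close>. Now
  \<open>s log_2 ((s + m) / 2) = s log_2 s - s + s log_2 (1 + m / s)\<close>, and the terms \<open>- s\<close> add up to \<open>-1\<close>.
\<close>

lemma info_pair_drop:
  assumes m: "mixture n A w x"
  shows "info n (pair_set A) (pair_weight w) (pair_mid x) \<le> info n A w x - 1
    + (\<Sum>j\<le>n. \<Sum>i\<in>A. w i * (x i j * log 2 (1 + mean A w x j / x i j)))"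
proof -
  let ?l = "\<lambda>i j. x i j * log 2 (1 + mean A w x j / x i j)"
  have x0: "0 \<le> x i j" if "i \<in> A" for i j using mixture_point[OF m that] simplex_nonneg by blast
  have coord: "(\<Sum>k\<in>pair_set A. pair_weight w k * plogp (pair_mid x k j))
     \<le> (\<Sum>i\<in>A. w i * plogp (x i j)) - mean A w x j + (\<Sum>i\<in>A. w i * ?l i j)" for j
  proof -
    let ?p = "mean A w x j"
    define g where "g i k = x i j * log 2 ((x i j + x k j) / 2)" for i k
    have p0: "0 \<le> ?p" using mean_nonneg x0 mixture_weight[OF m] by metis
    have "(\<Sum>k\<in>pair_set A. pair_weight w k * plogp (pair_mid x k j))
       = (\<Sum>i\<in>A. \<Sum>k\<in>A. w i * w k * plogp ((x i j + x k j) / 2))"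
      unfolding pair_mid_def by (rule sum_pair)
    also have "\<dots> = (\<Sum>i\<in>A. \<Sum>k\<in>A. (w i * w k * g i k + w k * w i * g k i) / 2)"
      by (intro sum.cong refl) (simp add: plogp_def g_def field_simps)
    also have "\<dots> = ((\<Sum>i\<in>A. \<Sum>k\<in>A. w i * w k * g i k) + (\<Sum>i\<in>A. \<Sum>k\<in>A. w k * w i * g k i)) / 2"
      by (simp add: sum.distrib flip: sum_divide_distrib)
    also have "(\<Sum>i\<in>A. \<Sum>k\<in>A. w k * w i * g k i) = (\<Sum>i\<in>A. \<Sum>k\<in>A. w i * w k * g i k)"
      by (rule sum.swap)
    also have "((\<Sum>i\<in>A. \<Sum>k\<in>A. w i * w k * g i k) + (\<Sum>i\<in>A. \<Sum>k\<in>A. w i * w k * g i k)) / 2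
       = (\<Sum>i\<in>A. w i * (\<Sum>k\<in>A. w k * g i k))"
      by (simp add: sum_distrib_left sum_distrib_right mult_ac)
    also have "\<dots> \<le> (\<Sum>i\<in>A. w i * (plogp (x i j) - x i j + ?l i j))"
    proof (intro sum_mono mult_left_mono)
      fix i assume i: "i \<in> A"
      show "0 \<le> w i" using i mixture_weight[OF m] by simp
      show "(\<Sum>k\<in>A. w k * g i k) \<le> plogp (x i j) - x i j + ?l i j"
      proof (cases "x i j = 0")
        case True
        then show ?thesis by (simp add: g_def)
      next
        case False
        then have xi: "0 < x i j" using x0[OF i, of j] by simp
        have mm: "(x i j + ?p) / 2 = (\<Sum>k\<in>A. w k * ((x i j + x k j) / 2))"
          using sum_convex_affine[OF mixture_sum[OF m], of "\<lambda>k. x k j" "1/2" "x i j / 2"]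
          by (simp add: mean_def add_divide_distrib add.commute)
        have "(\<Sum>k\<in>A. w k * log 2 ((x i j + x k j) / 2)) \<le> log 2 ((x i j + ?p) / 2)"
          by (rule log2_jensen[OF mixture_finite[OF m] mixture_weight[OF m] mixture_sum[OF m] _ mm])
            (use xi x0 p0 in \<open>auto intro: add_pos_nonneg\<close>)
        also have "(x i j + ?p) / 2 = x i j * (1 + ?p / x i j) / 2" using xi by (simp add: field_simps)
        also have "log 2 (x i j * (1 + ?p / x i j) / 2)
            = log 2 (x i j) + log 2 (1 + ?p / x i j) - 1"
        proof -
          have "0 < 1 + ?p / x i j" using xi p0 by (simp add: add_pos_nonneg)
          then show ?thesis using xi by (simp add: log_divide log_mult)
        qed
        finally have "x i j * (\<Sum>k\<in>A. w k * log 2 ((x i j + x k j) / 2))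
           \<le> x i j * (log 2 (x i j) + log 2 (1 + ?p / x i j) - 1)"
          using xi by (intro mult_left_mono) auto
        then show ?thesis
          by (simp add: g_def plogp_def sum_distrib_left algebra_simps)
      qed
    qed
    also have "\<dots> = (\<Sum>i\<in>A. w i * plogp (x i j)) - ?p + (\<Sum>i\<in>A. w i * ?l i j)"
      by (simp add: mean_def algebra_simps sum.distrib sum_subtractf)
    finally show ?thesis .
  qed
  have "info n (pair_set A) (pair_weight w) (pair_mid x)
     \<le> (\<Sum>j\<le>n. ((\<Sum>i\<in>A. w i * plogp (x i j)) - plogp (mean A w x j)) - mean A w x j
              + (\<Sum>i\<in>A. w i * ?l i j))"
    unfolding info_coords mean_pair[OF mixture_sum[OF m]]
    by (rule sum_mono) (use coord in \<open>simp add: algebra_simps\<close>)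
  also have "\<dots> = info n A w x - mass n (mean A w x) + (\<Sum>j\<le>n. \<Sum>i\<in>A. w i * ?l i j)"
    unfolding info_coords mass_def by (simp add: sum.distrib sum_subtractf)
  finally show ?thesis using simplex_mass[OF mean_in_simplex[OF m]] by simp
qed

definition var :: "nat set \<Rightarrow> (nat \<Rightarrow> real) \<Rightarrow> (nat \<Rightarrow> nat \<Rightarrow> real) \<Rightarrow> nat \<Rightarrow> real"
  where "var A w z j = (\<Sum>i\<in>A. w i * (z i j - mean A w z j)\<^sup>2)"

lemma var_pair:
  assumes w: "sum w A = 1"
  shows "var (pair_set A) (pair_weight w) (pair_mid z) j = var A w z j / 2"
proof -
  let ?u = "\<lambda>i. z i j - mean A w z j"
  have "(\<Sum>i\<in>A. w i * ?u i) = 0"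
    using sum_convex_affine[OF w, of "\<lambda>i. z i j" 1 "- mean A w z j"] by (simp add: mean_def)
  then have prod: "(\<Sum>i\<in>A. \<Sum>k\<in>A. w i * w k * (?u i * ?u k)) = 0"
    using sum_product[of "\<lambda>i. w i * ?u i" A "\<lambda>k. w k * ?u k" A] by (simp add: mult_ac)
  have "var (pair_set A) (pair_weight w) (pair_mid z) j
      = (\<Sum>i\<in>A. \<Sum>k\<in>A. w i * w k * ((z i j + z k j) / 2 - mean A w z j)\<^sup>2)"
    unfolding var_def mean_pair[OF w] pair_mid_def by (rule sum_pair)
  also have "\<dots> = (\<Sum>i\<in>A. \<Sum>k\<in>A. (w i * w k * ((?u i)\<^sup>2 + (?u k)\<^sup>2)) / 4
                     + (w i * w k * (?u i * ?u k)) / 2)"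
    by (intro sum.cong refl) (simp add: power2_eq_square field_simps)
  also have "\<dots> = (\<Sum>i\<in>A. \<Sum>k\<in>A. w i * w k * ((?u i)\<^sup>2 + (?u k)\<^sup>2)) / 4
                     + (\<Sum>i\<in>A. \<Sum>k\<in>A. w i * w k * (?u i * ?u k)) / 2"
    by (simp only: sum.distrib sum_divide_distrib)
  also have "\<dots> = var A w z j / 2"
    unfolding prod sum_pair_sym[OF w] by (simp add: var_def)
  finally show ?thesis .
qed

text \<open>
  After \<open>k\<close> rounds the points are averages of \<open>2 ^ k\<close> independent ones. Each round costs at most \<open>d\<close> in
  the average of \<open>f\<close>. The vectors \<open>z i\<close> are parts of the points that are averaged along with them,
  and their variance is halved each time.
\<close>

lemma average_many:
  assumes m: "mixture n A w x" and mid: "midpoint_affine n d f"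
    and z: "\<And>i j. i \<in> A \<Longrightarrow> 0 \<le> z i j \<and> z i j \<le> x i j"
  shows "\<exists>A' w' x' z'. mixture n A' w' x' \<and> mean A' w' x' = mean A w x \<and>
    mean A' w' z' = mean A w z \<and> (\<forall>i\<in>A'. \<forall>j. 0 \<le> z' i j \<and> z' i j \<le> x' i j) \<and>
    info n A' w' x' \<le> info n A w x \<and>
    \<bar>(\<Sum>i\<in>A'. w' i * f (x' i)) - (\<Sum>i\<in>A. w i * f (x i))\<bar> \<le> real k * d \<and>
    (\<forall>j. var A' w' z' j = var A w z j / 2 ^ k)"
proof (induction k)
  case 0
  show ?case
    by (rule exI[of _ A], rule exI[of _ w], rule exI[of _ x], rule exI[of _ z]) (use m z in auto)
next
  case (Suc k)
  then obtain A' w' x' z' where h: "mixture n A' w' x'" "mean A' w' x' = mean A w x"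
    "mean A' w' z' = mean A w z" "\<forall>i\<in>A'. \<forall>j. 0 \<le> z' i j \<and> z' i j \<le> x' i j"
    "info n A' w' x' \<le> info n A w x"
    "\<bar>(\<Sum>i\<in>A'. w' i * f (x' i)) - (\<Sum>i\<in>A. w i * f (x i))\<bar> \<le> real k * d"
    "\<forall>j. var A' w' z' j = var A w z j / 2 ^ k" by blast
  let ?A = "pair_set A'" and ?w = "pair_weight w'" and ?x = "pair_mid x'" and ?z = "pair_mid z'"
  note w' = mixture_sum[OF h(1)]
  show ?case
  proof (rule exI[of _ ?A], rule exI[of _ ?w], rule exI[of _ ?x], rule exI[of _ ?z], intro conjI)
    show "mixture n ?A ?w ?x" by (rule mixture_pair[OF h(1)])
    show "mean ?A ?w ?x = mean A w x" "mean ?A ?w ?z = mean A w z"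
      using h(2,3) by (simp_all add: mean_pair[OF w'])
    show "\<forall>i\<in>?A. \<forall>j. 0 \<le> ?z i j \<and> ?z i j \<le> ?x i j"
    proof (intro ballI allI)
      fix i j assume "i \<in> ?A"
      then have "fst (prod_decode i) \<in> A'" "snd (prod_decode i) \<in> A'" using pair_setD by auto
      then have "0 \<le> z' (fst (prod_decode i)) j" "z' (fst (prod_decode i)) j \<le> x' (fst (prod_decode i)) j"
        "0 \<le> z' (snd (prod_decode i)) j" "z' (snd (prod_decode i)) j \<le> x' (snd (prod_decode i)) j"
        using h(4) by blast+
      then show "0 \<le> ?z i j \<and> ?z i j \<le> ?x i j" by (simp add: pair_mid_def)
    qed
    show "info n ?A ?w ?x \<le> info n A w x" using info_pair_le[OF h(1)] h(5) by linarith
    show "\<bar>(\<Sum>i\<in>?A. ?w i * f (?x i)) - (\<Sum>i\<in>A. w i * f (x i))\<bar> \<le> real (Suc k) * d"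
      using pair_average[OF h(1) mid] h(6) by (simp add: distrib_right)
    show "\<forall>j. var ?A ?w ?z j = var A w z j / 2 ^ Suc k"
      using h(7) by (simp add: var_pair[OF w'])
  qed
qed

lemma sum_weight_scaled: "(\<Sum>i\<in>A. w i * (c * x i j)) = c * mean A w x j"
  by (simp add: mean_def sum_distrib_left mult_ac)

lemma mean_mono:
  "(\<And>i. i \<in> A \<Longrightarrow> 0 \<le> w i \<and> x i j \<le> y i j) \<Longrightarrow> mean A w x j \<le> mean A w y j"
  unfolding mean_def by (intro sum_mono mult_left_mono) auto

section \<open>The self-improving estimate\<close>

text \<open>
  A vector \<open>q\<close> that is below most of the points \<open>x i\<close> makes part of the error cancel. With the deficit
  \<open>a i\<close> and the excess \<open>b i\<close> of \<open>x i\<close> over \<open>q\<close> one has \<open>x i + a i = q + b i\<close>, and the same identity for the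
  means. Quasi-additivity turns both identities into identities for the homogeneous extension, up
  to constants, in which \<open>q\<close> contributes the same amount. What remains is the error of the families
  \<open>a\<close> and \<open>b\<close>, whose total mass is \<open>1 - mass q\<close> plus twice the mass of the mean deficit.
  The information of \<open>a\<close> is bounded since \<open>a \<le> p\<close>, and that of \<open>b\<close> exceeds that of \<open>x\<close> by at most a
  constant since \<open>b \<le> x\<close> and the mean of \<open>b\<close> is at least \<open>p / 2\<close>.
\<close>

lemma overlap_bound:
  assumes m: "mixture n A w x" and mid: "midpoint_affine n (1/2) f"
    and B: "\<And>x. x \<in> standard_simplex n \<Longrightarrow> \<bar>f x\<bar> \<le> B"
    and D: "info_affine n f D"
    and q: "q \<in> pos_cone n" "\<And>j. q j \<le> mean A w x j / 2"
    and a: "a = (\<lambda>i j. max 0 (q j - x i j))"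
  shows "\<bar>f (mean A w x) - (\<Sum>i\<in>A. w i * f (x i))\<bar>
    \<le> info n A w x / 2 + 11 + D * (1 - mass n q + 2 * mass n (mean A w a))"
proof -
  define p where "p = mean A w x"
  define b where "b = (\<lambda>i j. max 0 (x i j - q j))"
  let ?F = "hom_ext n f"
  let ?a = "mean A w a" and ?b = "mean A w b"
  note w1 = mixture_sum[OF m] and w0 = mixture_weight[OF m] and fin = mixture_finite[OF m]
  have xc: "x i \<in> pos_cone n" if "i \<in> A" for i using mixture_point[OF m that] simplex_cone by blast
  have pS: "p \<in> standard_simplex n" unfolding p_def by (rule mean_in_simplex[OF m])
  have p0: "0 \<le> p j" for j using pS simplex_nonneg by blast
  have ac: "a i \<in> pos_cone n" and bc: "b i \<in> pos_cone n" if "i \<in> A" for i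
    using xc[OF that] q(1) by (auto simp: a b_def pos_cone_def)
  have amc: "?a \<in> pos_cone n" and bmc: "?b \<in> pos_cone n"
    unfolding mean_def using ac bc w0 by (auto intro!: cone_mean)
  have aq: "a i j \<le> q j" if "i \<in> A" for i j
    using coneD(1)[OF xc[OF that], of j] coneD(1)[OF q(1), of j] by (simp add: a)
  have bx: "b i j \<le> x i j" if "i \<in> A" for i j
    using coneD(1)[OF xc[OF that], of j] coneD(1)[OF q(1), of j] by (simp add: b_def)
  have qp: "q j \<le> p j" for j using q(2)[of j] p0[of j] by (simp add: p_def)
  have mq: "mass n q \<le> 1" using mass_mono[of q p n, OF qp] simplex_mass[OF pS] by simp
  have ma: "mass n (a i) \<le> 1" if "i \<in> A" for i
    using mass_mono[of "a i" q n, OF aq[OF that]] mq by simp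
  have mb: "mass n (b i) \<le> 1" if "i \<in> A" for i
    using mass_mono[of "b i" "x i" n, OF bx[OF that]] simplex_mass[OF mixture_point[OF m that]] by simp
  have mav: "mass n (mean A w v) \<le> 1" if "\<And>i. i \<in> A \<Longrightarrow> mass n (v i) \<le> 1" for v
  proof -
    have "(\<Sum>i\<in>A. w i * mass n (v i)) \<le> (\<Sum>i\<in>A. w i * 1)"
      by (intro sum_mono mult_left_mono that w0)
    then show ?thesis using w1 unfolding mean_def mass_mean by simp
  qed
  have split: "x i j + a i j = q j + b i j" for i j by (simp add: a b_def max_def)
  have split_mean: "p j + ?a j = q j + ?b j" for j
  proof -
    have "(\<Sum>i\<in>A. w i * (x i j + a i j)) = (\<Sum>i\<in>A. w i * (b i j * 1 + q j))"
      by (simp only: split mult_1_right add.commute[of "q j"])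
    then show ?thesis unfolding sum_convex_affine[OF w1]
      by (simp add: p_def mean_def distrib_left sum.distrib)
  qed
  have four: "\<bar>?F u - (?F q + ?F d - ?F c)\<bar> \<le> 4"
    if "u \<in> standard_simplex n" "c \<in> pos_cone n" "d \<in> pos_cone n" "mass n c \<le> 1" "mass n d \<le> 1"
      "\<And>j. u j + c j = q j + d j" for u c d
  proof -
    have "\<bar>?F (\<lambda>j. u j + c j) - (?F u + ?F c)\<bar> \<le> mass n u + mass n c"
      by (rule quasi_additive[OF mid B simplex_cone[OF that(1)] that(2)])
    moreover have "\<bar>?F (\<lambda>j. q j + d j) - (?F q + ?F d)\<bar> \<le> mass n q + mass n d"
      by (rule quasi_additive[OF mid B q(1) that(3)])
    moreover have "(\<lambda>j. u j + c j) = (\<lambda>j. q j + d j)" using that(6) by auto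
    ultimately show ?thesis using that(4,5) mq simplex_mass[OF that(1)] by (simp add: abs_le_iff)
  qed
  have e1: "\<bar>f p - (?F q + ?F ?b - ?F ?a)\<bar> \<le> 4"
    using four[OF pS amc bmc mav[OF ma] mav[OF mb] split_mean] hom_ext_simplex[OF pS] by simp
  have e2: "\<bar>(\<Sum>i\<in>A. w i * f (x i)) - (?F q + (\<Sum>i\<in>A. w i * ?F (b i)) - (\<Sum>i\<in>A. w i * ?F (a i)))\<bar> \<le> 4"
  proof -
    have "\<bar>\<Sum>i\<in>A. w i * (f (x i) - (?F q + ?F (b i) - ?F (a i)))\<bar> \<le> 4"
      by (rule sum_weight_abs_le[OF m])
        (use four mixture_point[OF m] ac bc ma mb split hom_ext_simplex in \<open>force\<close>)
    moreover have "(\<Sum>i\<in>A. w i * ?F q) = ?F q" using w1 by (simp flip: sum_distrib_right)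
    ultimately show ?thesis
      by (simp add: right_diff_distrib distrib_left sum.distrib sum_subtractf)
  qed
  have ea: "\<bar>?F ?a - (\<Sum>i\<in>A. w i * ?F (a i))\<bar> \<le> info n A w a / 2 + D * mass n ?a"
    by (rule info_affine_mean[OF D fin w0 w1 ac])
  have eb: "\<bar>?F ?b - (\<Sum>i\<in>A. w i * ?F (b i))\<bar> \<le> info n A w b / 2 + D * mass n ?b"
    by (rule info_affine_mean[OF D fin w0 w1 bc])
  have log_mean: "(\<Sum>i\<in>A. w i * (v i j * c)) = mean A w v j * c" for v j c
    by (simp add: mean_def sum_distrib_right mult.assoc)
  have ia: "info n A w a \<le> 2"
  proof -
    have "(\<Sum>i\<in>A. w i * plogp (a i j)) - plogp (?a j) \<le> 2 * p j" for j
    proof (cases "p j = 0")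
      case True
      then have z: "a i j = 0" if "i \<in> A" for i
        using aq[OF that, of j] qp[of j] coneD(1)[OF ac[OF that], of j] by simp
      then have "?a j = 0" by (simp add: mean_def)
      moreover have "(\<Sum>i\<in>A. w i * plogp (a i j)) = 0" by (rule sum.neutral) (simp add: z)
      ultimately show ?thesis using True by simp
    next
      case False
      then have pj: "0 < p j" using p0[of j] by simp
      have "(\<Sum>i\<in>A. w i * plogp (a i j)) \<le> (\<Sum>i\<in>A. w i * (a i j * log 2 (p j)))"
        unfolding plogp_def using aq qp coneD(1)[OF ac] w0
        by (intro sum_mono mult_left_mono plogp_mono_factor) (auto intro: order.trans)
      also have "\<dots> = ?a j * log 2 (p j)" by (rule log_mean)
      also have "\<dots> \<le> plogp (?a j) - (?a j - p j) / ln 2"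
        using plogp_tangent[OF coneD(1)[OF amc, of j] pj] by simp
      finally have "(\<Sum>i\<in>A. w i * plogp (a i j)) - plogp (?a j) \<le> p j / ln 2 - ?a j / ln 2"
        by (simp add: diff_divide_distrib)
      moreover have "p j / ln 2 \<le> 2 * p j" using mult_left_mono[OF inverse_ln2_le, of "p j"] pj by simp
      moreover have "0 \<le> ?a j / ln 2" using coneD(1)[OF amc, of j] by simp
      ultimately show ?thesis by linarith
    qed
    then have "info n A w a \<le> (\<Sum>j\<le>n. 2 * p j)" unfolding info_coords by (rule sum_mono)
    also have "\<dots> = 2" using simplex_mass[OF pS] by (simp add: mass_def flip: sum_distrib_left)
    finally show ?thesis .
  qed
  have ib: "info n A w b \<le> info n A w x + 3"
  proof -
    \<comment> \<open>Compare with the density relative to \<open>p\<close>: \<open>b \<le> x\<close> makes the average of \<open>b log_2 (b / p)\<close> no larger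
      than that of \<open>x log_2 (x / p)\<close> up to \<open>2 p\<close>, and \<open>?b \<ge> p / 2\<close> allows the change from \<open>p\<close> to \<open>?b\<close>.\<close>
    have "(\<Sum>i\<in>A. w i * plogp (b i j)) - plogp (?b j)
       \<le> ((\<Sum>i\<in>A. w i * plogp (x i j)) - plogp (p j)) + 3 * p j" for j
    proof (cases "p j = 0")
      case True
      have z: "b i j = x i j" if "i \<in> A" for i
        using True qp[of j] coneD(1)[OF xc[OF that], of j] coneD(1)[OF q(1), of j] by (simp add: b_def)
      then have "?b j = p j" by (simp add: mean_def p_def)
      moreover have "(\<Sum>i\<in>A. w i * plogp (b i j)) = (\<Sum>i\<in>A. w i * plogp (x i j))"
        by (rule sum.cong) (simp_all add: z)
      ultimately show ?thesis using True by simp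
    next
      case False
      then have pj: "0 < p j" using p0[of j] by simp
      have "(\<Sum>i\<in>A. w i * (plogp (b i j) - b i j * log 2 (p j)))
          \<le> (\<Sum>i\<in>A. w i * (plogp (x i j) - x i j * log 2 (p j) + 2 * p j))"
        using bx coneD(1)[OF bc] w0 pj by (intro sum_mono mult_left_mono rel_plogp_mono) auto
      moreover have "(\<Sum>i\<in>A. w i * (2 * p j)) = 2 * p j" using w1 by (simp flip: sum_distrib_right)
      ultimately have 1: "(\<Sum>i\<in>A. w i * plogp (b i j)) - ?b j * log 2 (p j)
          \<le> (\<Sum>i\<in>A. w i * plogp (x i j)) - p j * log 2 (p j) + 2 * p j"
        by (simp add: right_diff_distrib distrib_left sum.distrib sum_subtractf log_mean p_def)
      have half: "p j / 2 \<le> ?b j"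
        using split_mean[of j] q(2)[of j] coneD(1)[OF amc, of j] by (simp add: p_def)
      have le: "?b j \<le> p j" unfolding p_def by (rule mean_mono) (use bx w0 in auto)
      have "?b j * (log 2 (p j) - 1) \<le> ?b j * log 2 (?b j)"
      proof (rule mult_left_mono)
        have "log 2 (p j / 2) \<le> log 2 (?b j)" using half pj by (subst log_le_cancel_iff) auto
        then show "log 2 (p j) - 1 \<le> log 2 (?b j)" using pj by (simp add: log_divide)
      qed (use half pj in auto)
      then show ?thesis using 1 le by (simp add: plogp_def algebra_simps)
    qed
    then have "info n A w b \<le> (\<Sum>j\<le>n. ((\<Sum>i\<in>A. w i * plogp (x i j)) - plogp (p j)) + 3 * p j)"
      unfolding info_coords by (rule sum_mono)
    also have "\<dots> = info n A w x + 3 * mass n p"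
      unfolding info_coords p_def mass_def by (simp add: sum.distrib sum_distrib_left)
    finally show ?thesis using simplex_mass[OF pS] by simp
  qed
  have "mass n (\<lambda>j. p j + ?a j) = mass n (\<lambda>j. q j + ?b j)" using split_mean by simp
  then have "mass n ?b = 1 - mass n q + mass n ?a" using simplex_mass[OF pS] by (simp add: mass_add)
  then have "D * mass n ?a + D * mass n ?b = D * (1 - mass n q + 2 * mass n ?a)"
    by (simp only: distrib_left[symmetric]) simp
  then show ?thesis using e1 e2 ea eb ia ib unfolding p_def[symmetric] by linarith
qed

text \<open>
  For \<open>q\<close> equal to half the mean of \<open>z\<close> the deficit at one coordinate is controlled by the variance,
  since \<open>m / 2 - t \<le> (t - m)\<^sup>2 / (2 m)\<close> for all \<open>t\<close>, which is equivalent to \<open>0 \<le> t\<^sup>2\<close>.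
\<close>

lemma truncated_overlap:
  assumes m: "mixture n A w x" and p: "p = mean A w x"
    and z: "\<And>i j. i \<in> A \<Longrightarrow> 0 \<le> z i j \<and> z i j \<le> x i j"
    and v: "\<And>j. var A w z j \<le> K * p j * mean A w z j" and K: "0 \<le> K"
    and a: "a = (\<lambda>i j. max 0 (mean A w z j / 2 - x i j))"
  shows "mass n (mean A w a) \<le> K / 2"
proof -
  note w0 = mixture_weight[OF m]
  have p0: "0 \<le> p j" for j using simplex_nonneg[OF mean_in_simplex[OF m]] p by simp
  have "mean A w a j \<le> K / 2 * p j" for j
  proof -
    let ?z = "mean A w z j"
    have z0: "0 \<le> ?z" by (rule mean_nonneg) (use z w0 in auto)
    show ?thesis
    proof (cases "?z = 0")
      case True
      have "a i j = 0" if "i \<in> A" for i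
      proof -
        have "0 \<le> x i j" using z[OF that, of j] by linarith
        then show ?thesis by (simp add: a True)
      qed
      then have "mean A w a j = 0" unfolding mean_def by (intro sum.neutral) simp
      then show ?thesis using K p0[of j] by simp
    next
      case False
      then have zp: "0 < ?z" using z0 by simp
      have "a i j \<le> (z i j - ?z)\<^sup>2 / (2 * ?z)" if "i \<in> A" for i
      proof -
        have "(?z / 2 - z i j) * (2 * ?z) \<le> (z i j - ?z)\<^sup>2"
          using zero_le_power2[of "z i j"] by (simp add: power2_eq_square algebra_simps)
        then have "?z / 2 - z i j \<le> (z i j - ?z)\<^sup>2 / (2 * ?z)" using zp by (simp add: pos_le_divide_eq)
        moreover have "0 \<le> (z i j - ?z)\<^sup>2 / (2 * ?z)" using zp by simp
        ultimately show ?thesis using z[OF that, of j] unfolding a by linarith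
      qed
      then have "mean A w a j \<le> (\<Sum>i\<in>A. w i * ((z i j - ?z)\<^sup>2 / (2 * ?z)))"
        unfolding mean_def[of A w a] by (intro sum_mono mult_left_mono w0)
      also have "\<dots> = var A w z j / (2 * ?z)" by (simp add: var_def sum_divide_distrib)
      also have "\<dots> \<le> K * p j * ?z / (2 * ?z)" using v[of j] zp by (intro divide_right_mono) auto
      also have "\<dots> = K / 2 * p j" using zp by simp
      finally show ?thesis .
    qed
  qed
  then have "mass n (mean A w a) \<le> mass n (\<lambda>j. K / 2 * p j)" by (rule mass_mono)
  also have "\<dots> = K / 2"
    unfolding mass_scale p using simplex_mass[OF mean_in_simplex[OF m]] by simp
  finally show ?thesis .
qed

text \<open>
  The dichotomy. Let \<open>z i\<close> be the part of \<open>x i\<close> where it is at most \<open>16 / e\<close> times the mean \<open>p\<close>. If the mean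
  of \<open>z\<close> has mass at most \<open>e\<^sup>2 / 256\<close>, then one doubling lowers the information by at least \<open>1 - 3 e / 8\<close>.
  Otherwise the variance of \<open>z\<close> is at most \<open>16 / e\<close> times \<open>p\<close> times its mean, and \<open>k\<close> doublings
  reduce the mean deficit with respect to half the mean of \<open>z\<close> to \<open>8 / (e 2 ^ k)\<close>, which the choice of \<open>k\<close>
  makes at most \<open>e\<^sup>2 / 2048\<close>, while the mass of half the mean of \<open>z\<close> exceeds \<open>e\<^sup>2 / 512\<close>.
\<close>

lemma gap_improve:
  assumes e: "0 < e" "e \<le> 1" and k: "16384 / e ^ 3 \<le> 2 ^ k"
    and mid: "midpoint_affine n ((1 - e) / 2) f"
    and B: "\<And>x. x \<in> standard_simplex n \<Longrightarrow> \<bar>f x\<bar> \<le> B"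
    and D: "info_affine n f D" "0 \<le> D" and m: "mixture n A w x"
  shows "\<bar>f (mean A w x) - (\<Sum>i\<in>A. w i * f (x i))\<bar>
    \<le> info n A w x / 2 + max (D - e / 4) (real k / 2 + 11 + D * (1 - e\<^sup>2 / 1024))"
proof -
  define p where "p = mean A w x"
  define z where "z = (\<lambda>i j. if x i j \<le> 16 / e * p j then x i j else 0)"
  have x0: "0 \<le> x i j" if "i \<in> A" for i j using mixture_point[OF m that] simplex_nonneg by blast
  have pS: "p \<in> standard_simplex n" unfolding p_def by (rule mean_in_simplex[OF m])
  have p0: "0 \<le> p j" for j using pS simplex_nonneg by blast
  have zx: "0 \<le> z i j \<and> z i j \<le> x i j" if "i \<in> A" for i j using x0[OF that] by (simp add: z_def)
  note w0 = mixture_weight[OF m] and w1 = mixture_sum[OF m]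
  define \<mu> where "\<mu> = mass n (mean A w z)"
  show ?thesis
  proof (cases "\<mu> \<le> e\<^sup>2 / 256")
    case True
    let ?A = "pair_set A" and ?w = "pair_weight w" and ?x = "pair_mid x"
    have "(\<Sum>j\<le>n. \<Sum>i\<in>A. w i * (x i j * log 2 (1 + p j / x i j)))
       \<le> (\<Sum>j\<le>n. \<Sum>i\<in>A. w i * (e / 8 * x i j + e / 8 * p j + 32 / e * z i j))"
      unfolding z_def using x0 p0 e w0
      by (intro sum_mono mult_left_mono doubling_loss_le) auto
    also have "\<dots> = (\<Sum>j\<le>n. e / 8 * p j + e / 8 * p j + 32 / e * mean A w z j)"
    proof (rule sum.cong[OF refl])
      fix j
      have "(\<Sum>i\<in>A. w i * (e / 8 * p j)) = sum w A * (e / 8 * p j)" by (simp only: sum_distrib_right)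
      then have "(\<Sum>i\<in>A. w i * (e / 8 * p j)) = e / 8 * p j" using w1 by simp
      then show "(\<Sum>i\<in>A. w i * (e / 8 * x i j + e / 8 * p j + 32 / e * z i j))
          = e / 8 * p j + e / 8 * p j + 32 / e * mean A w z j"
        unfolding distrib_left sum.distrib sum_weight_scaled by (simp add: p_def)
    qed
    also have "\<dots> = e / 4 * mass n p + 32 / e * \<mu>"
      by (simp add: \<mu>_def mass_def sum.distrib sum_distrib_left)
    also have "\<dots> \<le> e / 4 + 32 / e * (e\<^sup>2 / 256)"
      using simplex_mass[OF pS] True e by (intro add_mono mult_left_mono) auto
    also have "\<dots> = 3 / 8 * e" using e by (simp add: power2_eq_square)
    finally have "info n ?A ?w ?x \<le> info n A w x - 1 + 3 / 8 * e"
      using info_pair_drop[OF m] unfolding p_def by linarith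
    moreover have "\<bar>f (mean ?A ?w ?x) - (\<Sum>i\<in>?A. ?w i * f (?x i))\<bar> \<le> info n ?A ?w ?x / 2 + D"
      using D(1) mixture_pair[OF m] by (simp add: info_affine_def)
    moreover have "\<bar>(\<Sum>i\<in>?A. ?w i * f (?x i)) - (\<Sum>i\<in>A. w i * f (x i))\<bar> \<le> (1 - e) / 2"
      by (rule pair_average[OF m mid])
    ultimately have "\<bar>f (mean A w x) - (\<Sum>i\<in>A. w i * f (x i))\<bar> \<le> info n A w x / 2 + (D - e / 4)"
      unfolding mean_pair[OF w1] using e by argo
    then show ?thesis by linarith
  next
    case False
    have "\<exists>A' w' x' z'. mixture n A' w' x' \<and> mean A' w' x' = mean A w x \<and>
      mean A' w' z' = mean A w z \<and> (\<forall>i\<in>A'. \<forall>j. 0 \<le> z' i j \<and> z' i j \<le> x' i j) \<and>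
      info n A' w' x' \<le> info n A w x \<and>
      \<bar>(\<Sum>i\<in>A'. w' i * f (x' i)) - (\<Sum>i\<in>A. w i * f (x i))\<bar> \<le> real k * ((1 - e) / 2) \<and>
      (\<forall>j. var A' w' z' j = var A w z j / 2 ^ k)"
      by (rule average_many[OF m mid zx])
    then obtain A' w' x' z' where h: "mixture n A' w' x'" "mean A' w' x' = p"
      "mean A' w' z' = mean A w z" "\<And>i j. i \<in> A' \<Longrightarrow> 0 \<le> z' i j \<and> z' i j \<le> x' i j"
      "info n A' w' x' \<le> info n A w x"
      "\<bar>(\<Sum>i\<in>A'. w' i * f (x' i)) - (\<Sum>i\<in>A. w i * f (x i))\<bar> \<le> real k * ((1 - e) / 2)"
      "\<And>j. var A' w' z' j = var A w z j / 2 ^ k" unfolding p_def by blast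
    have var: "var A w z j \<le> 16 / e * p j * mean A w z j" for j
    proof -
      let ?z = "mean A w z j"
      have "var A w z j = (\<Sum>i\<in>A. w i * (z i j * z i j) - 2 * ?z * (w i * z i j) + w i * ?z\<^sup>2)"
        unfolding var_def by (intro sum.cong refl) (simp add: power2_eq_square algebra_simps)
      also have "\<dots> = (\<Sum>i\<in>A. w i * (z i j * z i j)) - 2 * ?z * (\<Sum>i\<in>A. w i * z i j) + sum w A * ?z\<^sup>2"
        by (simp only: sum.distrib sum_subtractf sum_distrib_left sum_distrib_right)
      also have "\<dots> = (\<Sum>i\<in>A. w i * (z i j * z i j)) - ?z\<^sup>2"
        using w1 by (simp add: power2_eq_square flip: mean_def[of A w z, THEN fun_cong])
      also have "\<dots> \<le> (\<Sum>i\<in>A. w i * (z i j * z i j))" by simp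
      also have "\<dots> \<le> (\<Sum>i\<in>A. w i * (16 / e * p j * z i j))"
      proof (intro sum_mono mult_left_mono w0 mult_right_mono)
        fix i assume i: "i \<in> A"
        have "0 \<le> 16 / e * p j" using e p0[of j] by simp
        then show "z i j \<le> 16 / e * p j" by (auto simp: z_def)
        show "0 \<le> z i j" using zx[OF i] by blast
      qed
      also have "\<dots> = 16 / e * p j * ?z" by (rule sum_weight_scaled)
      finally show ?thesis .
    qed
    let ?K = "16 / e / 2 ^ k"
    define q where "q = (\<lambda>j. 1 / 2 * mean A w z j)"
    define a where "a = (\<lambda>i j. max 0 (mean A' w' z' j / 2 - x' i j))"
    have a': "a = (\<lambda>i j. max 0 (q j - x' i j))" by (simp add: a_def q_def h(3))
    have mzc: "mean A w z \<in> pos_cone n"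
      unfolding mean_def
    proof (rule cone_mean)
      fix i assume i: "i \<in> A"
      show "0 \<le> w i \<and> z i \<in> pos_cone n"
        using w0[OF i] zx[OF i] simplex_beyond[OF mixture_point[OF m i]]
        by (auto simp: pos_cone_def z_def)
    qed
    have mid': "midpoint_affine n (1/2) f"
      by (rule midpoint_affine_mono[OF mid]) (use e in simp)
    have "\<bar>f (mean A' w' x') - (\<Sum>i\<in>A'. w' i * f (x' i))\<bar>
      \<le> info n A' w' x' / 2 + 11 + D * (1 - mass n q + 2 * mass n (mean A' w' a))"
    proof (rule overlap_bound[OF h(1) mid' B D(1) _ _ a'])
      show "q \<in> pos_cone n" unfolding q_def by (rule cone_scale[OF mzc]) simp
      show "q j \<le> mean A' w' x' j / 2" for j
        using mean_mono[of A w z j x] zx w0 by (simp add: q_def h(2) p_def)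
    qed
    moreover have "D * (1 - mass n q + 2 * mass n (mean A' w' a)) \<le> D * (1 - e\<^sup>2 / 1024)"
    proof (rule mult_left_mono[OF _ D(2)])
      have "mass n (mean A' w' a) \<le> ?K / 2"
      proof (rule truncated_overlap[OF h(1) h(2)[symmetric] h(4) _ _ a_def])
        show "var A' w' z' j \<le> ?K * p j * mean A' w' z' j" for j
          using divide_right_mono[OF var[of j], of "2 ^ k"] by (simp add: h(3,7))
      qed (use e in auto)
      moreover have "?K \<le> e\<^sup>2 / 1024"
        using k e by (simp add: field_simps power2_eq_square power3_eq_cube)
      moreover have "mass n q = \<mu> / 2" unfolding q_def mass_scale \<mu>_def by simp
      moreover have "1 - b + 2 * a \<le> 1 - E / 1024"
        if "a \<le> c / 2" "c \<le> E / 1024" "b = d / 2" "\<not> d \<le> E / 256" for a b c d E :: real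
        using that by linarith
      ultimately show "1 - mass n q + 2 * mass n (mean A' w' a) \<le> 1 - e\<^sup>2 / 1024"
        using False by blast
    qed
    moreover have "real k * ((1 - e) / 2) \<le> real k / 2"
      using e mult_left_mono[of "(1 - e) / 2" "1/2" "real k"] by simp
    ultimately have "\<bar>f (mean A w x) - (\<Sum>i\<in>A. w i * f (x i))\<bar>
       \<le> info n A w x / 2 + (real k / 2 + 11 + D * (1 - e\<^sup>2 / 1024))"
      using h(5,6) unfolding h(2) p_def[symmetric] by linarith
    then show ?thesis by linarith
  qed
qed

text \<open>
  The infimum \<open>D\<close> of all admissible constants for \<open>f\<close> is itself admissible. Since the improved constant
  of \<open>gap_improve\<close> is admissible too, \<open>D\<close> does not exceed it, which bounds \<open>D\<close> in terms of \<open>e\<close> alone. That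
  some constant is admissible to start with follows from the boundedness of \<open>f\<close>.
\<close>

lemma uniform_info_affine:
  fixes e :: real
  assumes e: "0 < e" "e \<le> 1"
  obtains K where "0 \<le> K" "\<And>n f B. midpoint_affine n ((1 - e) / 2) f \<Longrightarrow>
     (\<And>x. x \<in> standard_simplex n \<Longrightarrow> \<bar>f x\<bar> \<le> B) \<Longrightarrow> info_affine n f K"
proof -
  obtain k :: nat where k: "16384 / e ^ 3 \<le> 2 ^ k"
    using real_arch_pow[of 2 "16384 / e ^ 3"] by (auto intro: less_imp_le)
  define M where "M = real k / 2 + 11"
  define c where "c = e\<^sup>2 / 1024"
  have c: "0 < c" and M: "0 < M" using e by (auto simp: c_def M_def)
  show thesis
  proof (rule that)
    show "0 \<le> M / c" using c M by simp
    fix n f B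
    assume mid: "midpoint_affine n ((1 - e) / 2) f"
      and B: "\<And>x. x \<in> standard_simplex n \<Longrightarrow> \<bar>f x\<bar> \<le> B"
    define T where "T = {D. 0 \<le> D \<and> info_affine n f D}"
    have B0: "0 \<le> B" using B nonempty_standard_simplex[of n] by fastforce
    have "2 * B \<in> T" using info_affine_bounded[of n f B, OF B] B0 by (simp add: T_def)
    then have ne: "T \<noteq> {}" by blast
    have bdd: "bdd_below T" by (auto simp: T_def bdd_below_def)
    define D where "D = Inf T"
    have D0: "0 \<le> D" unfolding D_def by (rule cInf_greatest[OF ne]) (simp add: T_def)
    have aff: "info_affine n f D"
      unfolding info_affine_def
    proof (intro allI impI)
      fix A w x assume m: "mixture n A w x"
      have "\<bar>f (mean A w x) - (\<Sum>i\<in>A. w i * f (x i))\<bar> - info n A w x / 2 \<le> D"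
        unfolding D_def using m
        by (intro cInf_greatest[OF ne]) (fastforce simp: T_def info_affine_def)
      then show "\<bar>f (mean A w x) - (\<Sum>i\<in>A. w i * f (x i))\<bar> \<le> info n A w x / 2 + D" by simp
    qed
    define D' where "D' = max 0 (max (D - e / 4) (M + D * (1 - c)))"
    have "info_affine n f D'"
      unfolding info_affine_def
    proof (intro allI impI)
      fix A w x assume m: "mixture n A w x"
      show "\<bar>f (mean A w x) - (\<Sum>i\<in>A. w i * f (x i))\<bar> \<le> info n A w x / 2 + D'"
        using gap_improve[OF e k mid B aff D0 m] unfolding D'_def M_def c_def by linarith
    qed
    then have "D' \<in> T" by (simp add: T_def D'_def)
    then have "D \<le> D'" unfolding D_def using bdd by (rule cInf_lower)
    then have "D \<le> 0 \<or> D * c \<le> M" using e unfolding D'_def by (auto simp: algebra_simps max_def split: if_splits)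
    then have "D \<le> M / c"
    proof
      assume "D \<le> 0"
      also have "0 \<le> M / c" using c M by simp
      finally show ?thesis .
    qed (use c in \<open>simp add: pos_le_divide_eq\<close>)
    then show "info_affine n f (M / c)" using aff unfolding info_affine_def by fastforce
  qed
qed

section \<open>Supporting affine functions\<close>

text \<open>
  The Hahn-Banach argument is carried out one coordinate at a time: decreasing a sublinear functional
  until it is linear in the direction of each unit vector.
\<close>

definition sublinear :: "nat \<Rightarrow> ((nat \<Rightarrow> real) \<Rightarrow> real) \<Rightarrow> bool"
  where "sublinear n p \<longleftrightarrow>
    (\<forall>v\<in>rvecs n. \<forall>w\<in>rvecs n. p (\<lambda>j. v j + w j) \<le> p v + p w) \<and>
    (\<forall>v\<in>rvecs n. \<forall>t\<ge>0. p (\<lambda>j. t * v j) = t * p v)"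

lemma sublinearD:
  assumes "sublinear n p"
  shows sublinear_add: "v \<in> rvecs n \<Longrightarrow> w \<in> rvecs n \<Longrightarrow> p (\<lambda>j. v j + w j) \<le> p v + p w"
    and sublinear_scale: "v \<in> rvecs n \<Longrightarrow> 0 \<le> t \<Longrightarrow> p (\<lambda>j. t * v j) = t * p v"
  using assms by (auto simp: sublinear_def)

lemma sublinear_zero: "sublinear n p \<Longrightarrow> p (\<lambda>j. 0) = 0"
  using sublinear_scale[of n p "\<lambda>j. 0" 0] by (simp add: rvecs_iff)

lemma sublinear_neg:
  assumes p: "sublinear n p" and v: "v \<in> rvecs n"
  shows "- p (\<lambda>j. - v j) \<le> p v"
  using sublinear_add[OF p v, of "\<lambda>j. - v j"] sublinear_zero[OF p] v by (simp add: rvecs_iff)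

lemma rvecs_intros:
  "v \<in> rvecs n \<Longrightarrow> w \<in> rvecs n \<Longrightarrow> (\<lambda>j. v j + w j) \<in> rvecs n"
  "v \<in> rvecs n \<Longrightarrow> (\<lambda>j. t * v j) \<in> rvecs n"
  "v \<in> rvecs n \<Longrightarrow> (\<lambda>j. - v j) \<in> rvecs n"
  "(\<lambda>j. 0) \<in> rvecs n"
  "(\<And>i. i \<in> A \<Longrightarrow> f i \<in> rvecs n) \<Longrightarrow> (\<lambda>j. \<Sum>i\<in>A. f i j) \<in> rvecs n"
  by (auto simp: rvecs_iff)

text \<open>
  The functional \<open>p' v = inf {p (v + t e) - t p e | t \<ge> 0}\<close> is the standard one-dimensional
  extension step: taking \<open>t = 1\<close> at \<open>- e\<close> gives \<open>p' (- e) \<le> - p e\<close>, so \<open>p'\<close> is linear along \<open>e\<close>.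
\<close>

lemma sublinear_reduce:
  assumes p: "sublinear n p" and e: "e \<in> rvecs n"
  obtains p' where "sublinear n p'" "\<And>v. v \<in> rvecs n \<Longrightarrow> p' v \<le> p v"
    "p' (\<lambda>j. - e j) \<le> - p e"
proof -
  define g where "g v t = p (\<lambda>j. v j + t * e j) - t * p e" for v t
  define p' where "p' v = (INF t\<in>{0..}. g v t)" for v
  have lower: "- p (\<lambda>j. - v j) \<le> g v t" if v: "v \<in> rvecs n" and t: "0 \<le> t" for v t
  proof -
    have "p (\<lambda>j. (v j + t * e j) + - v j) \<le> p (\<lambda>j. v j + t * e j) + p (\<lambda>j. - v j)"
      by (intro sublinear_add[OF p] rvecs_intros v e)
    moreover have "p (\<lambda>j. (v j + t * e j) + - v j) = t * p e"
      using sublinear_scale[OF p e t] by simp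
    ultimately show ?thesis by (simp add: g_def)
  qed
  have bdd: "bdd_below (g v ` {0..})" if "v \<in> rvecs n" for v
    using lower[OF that] by (intro bdd_belowI2[of _ "- p (\<lambda>j. - v j)"]) auto
  have up: "p' v \<le> g v t" if "v \<in> rvecs n" "0 \<le> t" for v t
    unfolding p'_def by (rule cINF_lower[OF bdd[OF that(1)]]) (use that in auto)
  have least: "b \<le> p' v" if "\<And>t. 0 \<le> t \<Longrightarrow> b \<le> g v t" for b v
    unfolding p'_def by (rule cINF_greatest) (use that in auto)
  have sub: "p' (\<lambda>j. v j + w j) \<le> p' v + p' w" if v: "v \<in> rvecs n" and w: "w \<in> rvecs n" for v w
  proof -
    have "p' (\<lambda>j. v j + w j) - g w s \<le> p' v" if s: "0 \<le> s" for s
    proof (rule least)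
      fix t :: real assume t: "0 \<le> t"
      have "p' (\<lambda>j. v j + w j) \<le> g (\<lambda>j. v j + w j) (t + s)"
        by (intro up rvecs_intros v w) (use s t in auto)
      also have "\<dots> = p (\<lambda>j. (v j + t * e j) + (w j + s * e j)) - (t + s) * p e"
        by (simp add: g_def algebra_simps)
      also have "\<dots> \<le> p (\<lambda>j. v j + t * e j) + p (\<lambda>j. w j + s * e j) - (t + s) * p e"
        by (intro diff_right_mono sublinear_add[OF p] rvecs_intros v w e)
      finally show "p' (\<lambda>j. v j + w j) - g w s \<le> g v t" by (simp add: g_def algebra_simps)
    qed
    then have "p' (\<lambda>j. v j + w j) - p' v \<le> p' w" by (intro least) (simp add: algebra_simps)
    then show ?thesis by simp
  qed
  have le: "p' (\<lambda>j. t * v j) \<le> t * p' v" if v: "v \<in> rvecs n" and t: "0 < t" for v t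
  proof -
    have "p' (\<lambda>j. t * v j) / t \<le> p' v"
    proof (rule least)
      fix s :: real assume s: "0 \<le> s"
      have "p' (\<lambda>j. t * v j) \<le> g (\<lambda>j. t * v j) (t * s)"
        by (intro up rvecs_intros v) (use s t in auto)
      also have "\<dots> = p (\<lambda>j. t * (v j + s * e j)) - t * s * p e"
        by (simp add: g_def algebra_simps)
      also have "p (\<lambda>j. t * (v j + s * e j)) = t * p (\<lambda>j. v j + s * e j)"
        by (intro sublinear_scale[OF p] rvecs_intros v e) (use t in auto)
      finally show "p' (\<lambda>j. t * v j) / t \<le> g v s" using t by (simp add: g_def field_simps)
    qed
    then show ?thesis using t by (simp add: field_simps)
  qed
  have scale: "p' (\<lambda>j. t * v j) = t * p' v" if v: "v \<in> rvecs n" and t: "0 \<le> t" for v t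
  proof (cases "t = 0")
    case True
    have "g (\<lambda>j. 0) s = 0" if "0 \<le> s" for s
      using sublinear_scale[OF p e that] by (simp add: g_def)
    then have "p' (\<lambda>j. 0) = 0" unfolding p'_def by (simp cong: INF_cong_simp)
    then show ?thesis using True by simp
  next
    case False
    then have t': "0 < t" using t by simp
    have "p' (\<lambda>j. (1 / t) * (t * v j)) \<le> (1 / t) * p' (\<lambda>j. t * v j)"
      by (intro le rvecs_intros v) (use t' in auto)
    then have "t * p' v \<le> p' (\<lambda>j. t * v j)" using t' by (simp add: field_simps)
    then show ?thesis using le[OF v t'] by simp
  qed
  show thesis
  proof (rule that)
    show "sublinear n p'" unfolding sublinear_def using sub scale by blast
    show "p' v \<le> p v" if "v \<in> rvecs n" for v using up[OF that, of 0] by (simp add: g_def)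
    show "p' (\<lambda>j. - e j) \<le> - p e"
      using up[of "\<lambda>j. - e j" 1] e sublinear_zero[OF p] by (simp add: g_def rvecs_iff)
  qed
qed

text \<open>
  Linearity along a direction survives later reductions, since \<open>p' (- e)\<close> and \<open>p' e\<close> can only decrease.
\<close>

lemma sublinear_reduce_list:
  assumes "sublinear n p" and "set es \<subseteq> rvecs n"
  shows "\<exists>p'. sublinear n p' \<and> (\<forall>v\<in>rvecs n. p' v \<le> p v) \<and> (\<forall>e\<in>set es. p' (\<lambda>j. - e j) \<le> - p' e)"
  using assms
proof (induction es arbitrary: p)
  case Nil
  then show ?case by auto
next
  case (Cons e es)
  then have e: "e \<in> rvecs n" by simp
  obtain p1 where p1: "sublinear n p1" "\<And>v. v \<in> rvecs n \<Longrightarrow> p1 v \<le> p v"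
    "p1 (\<lambda>j. - e j) \<le> - p e"
    using sublinear_reduce[OF Cons.prems(1) e] by blast
  obtain p2 where p2: "sublinear n p2" "\<forall>v\<in>rvecs n. p2 v \<le> p1 v"
    "\<forall>e\<in>set es. p2 (\<lambda>j. - e j) \<le> - p2 e"
    using Cons.IH[OF p1(1)] Cons.prems(2) by auto
  have "p2 (\<lambda>j. - e j) \<le> p1 (\<lambda>j. - e j)" "p2 e \<le> p1 e" "p1 e \<le> p e"
    using p2(2) p1(2) e rvecs_intros(3) by blast+
  then have "p2 (\<lambda>j. - e j) \<le> - p2 e" using p1(3) by linarith
  then show ?case using p2 p1(2) by (intro exI[of _ p2]) (auto intro: order.trans)
qed

text \<open>
  Reducing along \<open>u\<close> first pins down the value \<open>p u\<close>; after the unit vectors the functional is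
  linear.
\<close>

lemma sublinear_support:
  assumes p: "sublinear n p" and u: "u \<in> rvecs n"
  obtains c where "\<And>v. v \<in> rvecs n \<Longrightarrow> (\<Sum>j\<le>n. c j * v j) \<le> p v" "p u \<le> (\<Sum>j\<le>n. c j * u j)"
proof -
  define e :: "nat \<Rightarrow> nat \<Rightarrow> real" where "e i = (\<lambda>j. if j = i then 1 else 0)" for i
  have e: "e i \<in> rvecs n" if "i \<le> n" for i using that by (auto simp: e_def rvecs_iff)
  obtain p1 where p1: "sublinear n p1" "\<And>v. v \<in> rvecs n \<Longrightarrow> p1 v \<le> p v"
    "p1 (\<lambda>j. - u j) \<le> - p u"
    using sublinear_reduce[OF p u] by blast
  obtain q where q: "sublinear n q" "\<forall>v\<in>rvecs n. q v \<le> p1 v"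
    "\<forall>v\<in>set (map e [0..<Suc n]). q (\<lambda>j. - v j) \<le> - q v"
  proof -
    have "set (map e [0..<Suc n]) \<subseteq> rvecs n" using e by (auto simp: less_Suc_eq_le simp del: upt_Suc)
    then show thesis using sublinear_reduce_list[OF p1(1)] that by blast
  qed
  have neg: "q (\<lambda>j. - e i j) \<le> - q (e i)" if "i \<le> n" for i
    using q(3) that by (auto simp: less_Suc_eq_le simp del: upt_Suc)
  define c where "c i = q (e i)" for i
  have one: "q (\<lambda>j. t * e i j) \<le> c i * t" if i: "i \<le> n" for i t
  proof (cases "0 \<le> t")
    case True
    then show ?thesis using sublinear_scale[OF q(1) e[OF i] True] by (simp add: c_def)
  next
    case False
    have "q (\<lambda>j. (- t) * (- e i j)) = (- t) * q (\<lambda>j. - e i j)"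
      by (intro sublinear_scale[OF q(1)] rvecs_intros e i) (use False in auto)
    also have "\<dots> \<le> (- t) * (- q (e i))" using False neg[OF i] by (intro mult_left_mono) auto
    finally show ?thesis by (simp add: c_def mult.commute)
  qed
  have partial: "q (\<lambda>j. \<Sum>i<k. v i * e i j) \<le> (\<Sum>i<k. c i * v i)" if "k \<le> Suc n" for k v
    using that
  proof (induction k)
    case 0
    then show ?case using sublinear_zero[OF q(1)] by simp
  next
    case (Suc k)
    have "q (\<lambda>j. (\<Sum>i<k. v i * e i j) + v k * e k j)
        \<le> q (\<lambda>j. \<Sum>i<k. v i * e i j) + q (\<lambda>j. v k * e k j)"
      by (intro sublinear_add[OF q(1)] rvecs_intros e) (use Suc in auto)
    then show ?case using Suc one[of k "v k"] by simp
  qed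
  have expand: "(\<lambda>j. \<Sum>i<Suc n. v i * e i j) = v" if "v \<in> rvecs n" for v
  proof
    fix j
    have "(\<Sum>i<Suc n. v i * e i j) = (\<Sum>i<Suc n. if j = i then v j else 0)"
      by (rule sum.cong) (auto simp: e_def)
    also have "\<dots> = v j" using that by (auto simp: rvecs_iff not_less)
    finally show "(\<Sum>i<Suc n. v i * e i j) = v j" .
  qed
  have up: "q v \<le> (\<Sum>j\<le>n. c j * v j)" if "v \<in> rvecs n" for v
    using partial[of "Suc n" v] expand[OF that] by (simp add: lessThan_Suc_atMost)
  have lo: "(\<Sum>j\<le>n. c j * v j) \<le> q v" if v: "v \<in> rvecs n" for v
    using up[OF rvecs_intros(3)[OF v]] sublinear_neg[OF q(1) v] by (simp add: sum_negf)
  show thesis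
  proof (rule that)
    show "(\<Sum>j\<le>n. c j * v j) \<le> p v" if "v \<in> rvecs n" for v
      using lo[OF that] q(2) p1(2)[OF that] that by fastforce
    have "- q (\<lambda>j. - u j) \<le> q u" by (rule sublinear_neg[OF q(1) u])
    moreover have "q (\<lambda>j. - u j) \<le> - p u"
      using q(2) p1(3) rvecs_intros(3)[OF u] by fastforce
    ultimately show "p u \<le> (\<Sum>j\<le>n. c j * u j)" using up[OF u] by linarith
  qed
qed

text \<open>
  Families of cone vectors are lists in this part, so that two families can be joined by appending them.
\<close>

definition vsum :: "(nat \<Rightarrow> real) list \<Rightarrow> nat \<Rightarrow> real"
  where "vsum vs = (\<lambda>j. \<Sum>v\<leftarrow>vs. v j)"

lemma vsum_eq_sum: "vsum vs = (\<lambda>j. \<Sum>i\<in>{..<length vs}. (vs ! i) j)"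
  by (simp add: vsum_def sum_list_sum_nth atLeast0LessThan)

lemma vsum_append: "vsum (vs @ ws) = (\<lambda>j. vsum vs j + vsum ws j)"
  by (simp add: vsum_def)

lemma cone_rvecs: "v \<in> pos_cone n \<Longrightarrow> v \<in> rvecs n"
  by (auto simp: pos_cone_def rvecs_iff)

text \<open>
  The convex hull of \<open>g\<close> on the cone, the infimum of \<open>\<Sum> hom_ext g (v_i)\<close> over all families with sum \<open>v\<close>, is
  made finite on the whole space by allowing families with sum \<open>v + s\<close> for any cone vector \<open>s\<close> at the
  price \<open>L\<close> times the mass of \<open>s\<close>. This keeps the functional below \<open>g\<close> on the simplex. It also
  keeps it close to \<open>g u\<close> at \<open>u\<close>, including boundary points \<open>u\<close> of the simplex: by almost convexity a
  family with sum \<open>u + s\<close> costs nearly the value at \<open>u + s\<close>, which by superadditivity is at least the sum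
  of the values at \<open>u\<close> and at \<open>s\<close> up to constants, and for large \<open>L\<close> the price of \<open>s\<close> outweighs the
  value at \<open>s\<close> and the errors proportional to its mass.
\<close>

lemma almost_convex_support:
  assumes B: "\<And>x. x \<in> standard_simplex n \<Longrightarrow> \<bar>g x\<bar> \<le> B"
    and sub: "\<And>vs. set vs \<subseteq> pos_cone n \<Longrightarrow>
      hom_ext n g (vsum vs) \<le> (\<Sum>v\<leftarrow>vs. hom_ext n g v) + D * mass n (vsum vs)"
    and sup: "\<And>v w. v \<in> pos_cone n \<Longrightarrow> w \<in> pos_cone n \<Longrightarrow>
      hom_ext n g v + hom_ext n g w \<le> hom_ext n g (\<lambda>j. v j + w j) + K * (mass n v + mass n w)"
    and D: "0 \<le> D" and K: "0 \<le> K" and u: "u \<in> standard_simplex n"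
  obtains c where "\<And>v. v \<in> standard_simplex n \<Longrightarrow> (\<Sum>j\<le>n. c j * v j) \<le> g v"
    "g u - (D + K) \<le> (\<Sum>j\<le>n. c j * u j)"
proof -
  let ?G = "hom_ext n g"
  have B0: "0 \<le> B" using B[OF u] by linarith
  \<comment> \<open>The price of adding \<open>s\<close>: \<open>B\<close> pays for the value of \<open>g\<close> at \<open>s\<close>, \<open>D + K\<close> for the errors.\<close>
  define L where "L = B + D + K"
  define val where "val vs s = (\<Sum>v\<leftarrow>vs. ?G v) + L * mass n s" for vs s
  define rep where "rep v vs s \<longleftrightarrow> set vs \<subseteq> pos_cone n \<and> s \<in> pos_cone n \<and> (\<forall>j. vsum vs j = v j + s j)" for v vs s
  define V where "V v = {r. \<exists>vs s. rep v vs s \<and> r = val vs s}" for v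
  define p where "p v = Inf (V v)" for v
  have massG: "- (B * mass n (vsum vs)) \<le> (\<Sum>v\<leftarrow>vs. ?G v)" if "set vs \<subseteq> pos_cone n" for vs
    using that
  proof (induction vs)
    case (Cons v vs)
    have "\<bar>?G v\<bar> \<le> B * mass n v" using Cons.prems by (intro hom_ext_bound B) auto
    moreover have "mass n (vsum (v # vs)) = mass n v + mass n (vsum vs)"
      using mass_add[of n v "vsum vs"] by (simp add: vsum_def)
    ultimately show ?case using Cons by (simp add: abs_le_iff algebra_simps)
  qed (simp add: vsum_def)
  have rep_mass: "mass n (vsum vs) = mass n v + mass n s" if "rep v vs s" for v vs s
  proof -
    have "vsum vs = (\<lambda>j. v j + s j)" using that by (auto simp: rep_def)
    then show ?thesis by (simp add: mass_add)
  qed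
  have lower: "- (B * mass n v) \<le> r" if rV: "r \<in> V v" for v r
  proof -
    obtain vs s where h: "rep v vs s" "r = val vs s" using rV unfolding V_def by blast
    have "- (B * (mass n v + mass n s)) \<le> (\<Sum>v\<leftarrow>vs. ?G v)"
      using massG[of vs] h(1) rep_mass[OF h(1)] by (simp add: rep_def)
    moreover have "B * mass n s \<le> L * mass n s"
      using h(1) D K by (intro mult_right_mono mass_nonneg) (auto simp: L_def rep_def)
    ultimately show ?thesis by (simp add: h(2) val_def algebra_simps)
  qed
  have bdd: "bdd_below (V v)" for v using lower by (auto simp: bdd_below_def)
  have ne: "V v \<noteq> {}" if "v \<in> rvecs n" for v
  proof -
    have "rep v [\<lambda>j. max 0 (v j)] (\<lambda>j. max 0 (- v j))"
      using that by (auto simp: rep_def vsum_def pos_cone_def rvecs_iff max_def)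
    then show ?thesis by (auto simp: V_def)
  qed
  have pup: "p v \<le> val vs s" if "rep v vs s" for v vs s
    unfolding p_def by (rule cInf_lower[OF _ bdd]) (use that in \<open>auto simp: V_def\<close>)
  have pleast: "b \<le> p v" if "v \<in> rvecs n" "\<And>vs s. rep v vs s \<Longrightarrow> b \<le> val vs s" for b v
    unfolding p_def by (rule cInf_greatest[OF ne[OF that(1)]]) (use that in \<open>auto simp: V_def\<close>)
  have add: "p (\<lambda>j. v j + w j) \<le> p v + p w" if v: "v \<in> rvecs n" and w: "w \<in> rvecs n" for v w
  proof -
    have "p (\<lambda>j. v j + w j) - val ws t \<le> p v" if t: "rep w ws t" for ws t
    proof (rule pleast[OF v])
      fix vs s assume s: "rep v vs s"
      have "rep (\<lambda>j. v j + w j) (vs @ ws) (\<lambda>j. s j + t j)"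
        using s t cone_add[of s n t] by (auto simp: rep_def vsum_append)
      from pup[OF this] show "p (\<lambda>j. v j + w j) - val ws t \<le> val vs s"
        by (simp add: val_def mass_add algebra_simps)
    qed
    then have "p (\<lambda>j. v j + w j) - p v \<le> p w" by (intro pleast w) (simp add: algebra_simps)
    then show ?thesis by simp
  qed
  have le: "p (\<lambda>j. t * v j) \<le> t * p v" if v: "v \<in> rvecs n" and t: "0 < t" for v t
  proof -
    have "p (\<lambda>j. t * v j) / t \<le> p v"
    proof (rule pleast[OF v])
      fix vs s assume s: "rep v vs s"
      have "rep (\<lambda>j. t * v j) (map (\<lambda>v j. t * v j) vs) (\<lambda>j. t * s j)"
        using s t cone_scale[of _ n t]
        by (auto simp: rep_def vsum_def o_def sum_list_const_mult distrib_left)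
      from pup[OF this] have "p (\<lambda>j. t * v j) \<le> t * val vs s"
        by (simp add: val_def mass_scale o_def hom_ext_scale sum_list_const_mult algebra_simps)
      then show "p (\<lambda>j. t * v j) / t \<le> val vs s" using t by (simp add: field_simps)
    qed
    then show ?thesis using t by (simp add: field_simps)
  qed
  have zero: "p (\<lambda>j. 0) = 0"
  proof (rule antisym)
    have "rep (\<lambda>j. 0) [] (\<lambda>j. 0)" by (simp add: rep_def vsum_def)
    from pup[OF this] show "p (\<lambda>j. 0) \<le> 0" by (simp add: val_def)
    show "0 \<le> p (\<lambda>j. 0)"
      by (rule pleast) (use lower[of _ "\<lambda>j. 0"] in \<open>auto simp: rvecs_iff V_def\<close>)
  qed
  have scale: "p (\<lambda>j. t * v j) = t * p v" if v: "v \<in> rvecs n" and t: "0 \<le> t" for v t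
  proof (cases "t = 0")
    case False
    then have t': "0 < t" using t by simp
    have "p (\<lambda>j. (1 / t) * (t * v j)) \<le> (1 / t) * p (\<lambda>j. t * v j)"
      by (intro le rvecs_intros v) (use t' in auto)
    then have "t * p v \<le> p (\<lambda>j. t * v j)" using t' by (simp add: field_simps)
    then show ?thesis using le[OF v t'] by simp
  qed (simp add: zero)
  have "sublinear n p" unfolding sublinear_def using add scale by blast
  moreover have ur: "u \<in> rvecs n" using cone_rvecs[OF simplex_cone[OF u]] .
  ultimately obtain c where c: "\<And>v. v \<in> rvecs n \<Longrightarrow> (\<Sum>j\<le>n. c j * v j) \<le> p v"
    "p u \<le> (\<Sum>j\<le>n. c j * u j)" using sublinear_support by blast
  have "g u - (D + K) \<le> p u"
  proof (rule pleast[OF ur])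
    fix vs s assume s: "rep u vs s"
    have sc: "s \<in> pos_cone n" and vc: "set vs \<subseteq> pos_cone n" using s by (auto simp: rep_def)
    have "vsum vs = (\<lambda>j. u j + s j)" using s by (auto simp: rep_def)
    then have "?G u + ?G s \<le> ?G (vsum vs) + K * (1 + mass n s)"
      using sup[OF simplex_cone[OF u] sc] simplex_mass[OF u] by simp
    moreover have "?G (vsum vs) \<le> (\<Sum>v\<leftarrow>vs. ?G v) + D * (1 + mass n s)"
      using sub[OF vc] rep_mass[OF s] simplex_mass[OF u] by simp
    moreover have "\<bar>?G s\<bar> \<le> B * mass n s" by (rule hom_ext_bound[OF B sc])
    ultimately show "g u - (D + K) \<le> val vs s"
      unfolding val_def L_def hom_ext_simplex[OF u] by (simp add: algebra_simps abs_le_iff)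
  qed
  moreover have "p v \<le> g v" if v: "v \<in> standard_simplex n" for v
  proof -
    have "rep v [v] (\<lambda>j. 0)" using simplex_cone[OF v] by (simp add: rep_def vsum_def)
    from pup[OF this] show ?thesis by (simp add: val_def hom_ext_simplex[OF v])
  qed
  ultimately show thesis
    using that[of c] c cone_rvecs[OF simplex_cone] by (meson order.trans)
qed

text \<open>
  For \<open>K = 0\<close> this is the existence of subgradients, so \<open>g\<close> is then convex; in general \<open>g\<close> exceeds its
  convex envelope by at most \<open>K\<close>.
\<close>

definition supportable :: "nat \<Rightarrow> real \<Rightarrow> ((nat \<Rightarrow> real) \<Rightarrow> real) \<Rightarrow> bool"
  where "supportable n K g \<longleftrightarrow> (\<forall>u\<in>standard_simplex n. \<exists>c.
    (\<forall>v\<in>standard_simplex n. (\<Sum>j\<le>n. c j * v j) \<le> g v) \<and> g u - K \<le> (\<Sum>j\<le>n. c j * u j))"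

lemma sum_list_as_sum: "(\<Sum>v\<leftarrow>vs. h v) = (\<Sum>i\<in>{..<length vs}. h (vs ! i))"
  by (simp add: sum_list_sum_nth atLeast0LessThan)

lemma supportable_add_half_negent:
  assumes mid: "midpoint_affine n (1/2) f"
    and B: "\<And>x. x \<in> standard_simplex n \<Longrightarrow> \<bar>f x\<bar> \<le> B"
    and D: "info_affine n f D" "0 \<le> D"
  shows "supportable n (D + 3/2) (\<lambda>u. f u + negent n u / 2)"
  unfolding supportable_def
proof
  let ?g = "\<lambda>u. f u + negent n u / 2"
  have G: "hom_ext n ?g v = hom_ext n f v + hom_ext n (negent n) v / 2" for v
    using hom_ext_add[of n 1 f "1/2" "negent n" v] by simp
  fix u assume u: "u \<in> standard_simplex n"
  have bound: "\<bar>?g x\<bar> \<le> B + real (Suc n)" if "x \<in> standard_simplex n" for x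
    using B[OF that] negent_nonpos[OF that] negent_lower[OF that] by (simp add: abs_le_iff)
  have sub: "hom_ext n ?g (vsum vs) \<le> (\<Sum>v\<leftarrow>vs. hom_ext n ?g v) + D * mass n (vsum vs)"
    if vs: "set vs \<subseteq> pos_cone n" for vs
  proof -
    have "vs ! i \<in> pos_cone n" if "i \<in> {..<length vs}" for i using vs that by (auto simp: set_conv_nth)
    then have "\<bar>hom_ext n f (vsum vs) - (\<Sum>i\<in>{..<length vs}. hom_ext n f (vs ! i))\<bar>
      \<le> ((\<Sum>i\<in>{..<length vs}. hom_ext n (negent n) (vs ! i)) - hom_ext n (negent n) (vsum vs)) / 2
        + D * mass n (vsum vs)"
      by (rule info_affine_sum[OF D(1) finite_lessThan _ vsum_eq_sum])
    then show ?thesis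
      unfolding G sum_list_as_sum sum.distrib sum_divide_distrib[symmetric] by argo
  qed
  have sup: "hom_ext n ?g v + hom_ext n ?g w
      \<le> hom_ext n ?g (\<lambda>j. v j + w j) + 3/2 * (mass n v + mass n w)"
    if v: "v \<in> pos_cone n" and w: "w \<in> pos_cone n" for v w
  proof -
    have "negent n v + negent n w \<le> negent n (\<lambda>j. v j + w j)"
      unfolding negent_def sum.distrib[symmetric] using coneD(1)[OF v] coneD(1)[OF w]
      by (intro sum_mono plogp_superadd) auto
    moreover have "plogp (mass n v + mass n w) \<le> plogp (mass n v) + plogp (mass n w) + (mass n v + mass n w)"
      by (rule plogp_binary[OF mass_nonneg[OF v] mass_nonneg[OF w]])
    moreover have "\<bar>hom_ext n f (\<lambda>j. v j + w j) - (hom_ext n f v + hom_ext n f w)\<bar> \<le> mass n v + mass n w"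
      by (rule quasi_additive[OF mid B v w])
    ultimately show ?thesis
      unfolding G hom_ext_negent[OF v] hom_ext_negent[OF w] hom_ext_negent[OF cone_add[OF v w]] mass_add
      by argo
  qed
  show "\<exists>c. (\<forall>v\<in>standard_simplex n. (\<Sum>j\<le>n. c j * v j) \<le> ?g v) \<and>
       ?g u - (D + 3/2) \<le> (\<Sum>j\<le>n. c j * u j)"
    by (rule almost_convex_support[OF bound sub sup D(2) _ u]) auto
qed

section \<open>Lattice norms from logarithmically convex balls\<close>

definition log_ball :: "nat \<Rightarrow> ((nat \<Rightarrow> real) \<Rightarrow> real) \<Rightarrow> (nat \<Rightarrow> real) set"
  where "log_ball n g = {y \<in> rvecs n. (\<forall>j\<le>n. 0 < y j) \<and>
    (\<forall>v\<in>standard_simplex n. (\<Sum>j\<le>n. v j * log 2 (y j)) \<le> g v)}"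

lemma log_ballD:
  assumes "y \<in> log_ball n g"
  shows log_ball_rvecs: "y \<in> rvecs n" and log_ball_pos: "j \<le> n \<Longrightarrow> 0 < y j"
    and log_ball_nonneg: "0 \<le> y j"
    and log_ball_le: "v \<in> standard_simplex n \<Longrightarrow> (\<Sum>j\<le>n. v j * log 2 (y j)) \<le> g v"
  using assms by (auto simp: log_ball_def rvecs_iff intro: less_imp_le) (metis less_imp_le not_le order_refl)

lemma supportable_log_ball:
  assumes "supportable n K g" and u: "u \<in> standard_simplex n"
  obtains y where "y \<in> log_ball n g" "g u - K \<le> (\<Sum>j\<le>n. u j * log 2 (y j))"
proof -
  obtain c where c: "\<forall>v\<in>standard_simplex n. (\<Sum>j\<le>n. c j * v j) \<le> g v"
    "g u - K \<le> (\<Sum>j\<le>n. c j * u j)"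
    using assms by (auto simp: supportable_def)
  define y where "y j = (if j \<le> n then 2 powr c j else 0)" for j
  have eq: "(\<Sum>j\<le>n. v j * log 2 (y j)) = (\<Sum>j\<le>n. c j * v j)" for v
    by (rule sum.cong) (auto simp: y_def)
  show thesis
  proof (rule that[of y])
    show "y \<in> log_ball n g" unfolding log_ball_def mem_Collect_eq eq
      using c(1) by (simp add: rvecs_iff y_def)
    show "g u - K \<le> (\<Sum>j\<le>n. u j * log 2 (y j))" unfolding eq by (rule c(2))
  qed
qed

text \<open>
  Gibbs' inequality, for a vector \<open>t\<close> of total mass at most \<open>1\<close>. The second assumption on \<open>t\<close> keeps the
  convention \<open>log 2 0 = 0\<close> out of the sum.
\<close>

lemma gibbs:
  assumes u: "u \<in> standard_simplex n"
    and t: "\<And>j. j \<le> n \<Longrightarrow> 0 \<le> t j" "\<And>j. j \<le> n \<Longrightarrow> u j \<noteq> 0 \<Longrightarrow> t j \<noteq> 0" "(\<Sum>j\<le>n. t j) \<le> 1"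
  shows "(\<Sum>j\<le>n. u j * log 2 (t j)) \<le> negent n u"
proof -
  have "u j * log 2 (t j) \<le> plogp (u j) - (u j - t j) / ln 2" if j: "j \<le> n" for j
  proof (cases "u j = 0")
    case True
    then show ?thesis using t(1)[OF j] by simp
  next
    case False
    then show ?thesis
      using plogp_tangent[of "u j" "t j"] simplex_nonneg[OF u, of j] t(1,2)[OF j] by simp
  qed
  then have "(\<Sum>j\<le>n. u j * log 2 (t j)) \<le> (\<Sum>j\<le>n. plogp (u j) - (u j - t j) / ln 2)"
    by (intro sum_mono) auto
  also have "\<dots> = negent n u - (1 - (\<Sum>j\<le>n. t j)) / ln 2"
    using simplex_mass[OF u]
    by (simp add: negent_def mass_def sum_subtractf flip: sum_divide_distrib)
  also have "\<dots> \<le> negent n u" using t(3) by simp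
  finally show ?thesis .
qed

text \<open>
  With \<open>T = \<Sum> x_j y_j\<close>, the probability vector \<open>v = x y / T\<close> attains the maximum in the Gibbs variational
  principle: \<open>\<Lambda>(v) = \<Sum> v_j log_2 x_j + \<Sum> v_j log_2 y_j - log_2 T\<close>. The first two sums are at most
  \<open>g1 v + g2 v = \<Lambda>(v)\<close>, hence \<open>log_2 T \<le> 0\<close>.
\<close>

lemma log_ball_pairing:
  assumes g: "\<And>u. u \<in> standard_simplex n \<Longrightarrow> g1 u + g2 u = negent n u"
    and x: "x \<in> log_ball n g1" and y: "y \<in> log_ball n g2"
  shows "(\<Sum>j\<le>n. x j * y j) \<le> 1"
proof -
  define T where "T = (\<Sum>j\<le>n. x j * y j)"
  have pos: "0 < x j * y j" if "j \<le> n" for j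
    using log_ball_pos[OF x that] log_ball_pos[OF y that] by simp
  have T: "0 < T" unfolding T_def by (rule sum_pos) (use pos in auto)
  define v where "v j = x j * y j / T" for j
  have v: "v \<in> standard_simplex n"
  proof -
    have "mass n v = 1" using T by (simp add: mass_def v_def T_def flip: sum_divide_distrib)
    moreover have "v \<in> pos_cone n"
      using T log_ball_nonneg[OF x] log_ball_nonneg[OF y] log_ball_rvecs[OF x]
      by (auto simp: v_def pos_cone_def rvecs_iff)
    ultimately show ?thesis by (simp add: simplex_iff)
  qed
  have "plogp (v j) = v j * log 2 (x j) + v j * log 2 (y j) - v j * log 2 T" if j: "j \<le> n" for j
  proof -
    have lv: "log 2 (v j) = log 2 (x j) + log 2 (y j) - log 2 T"
      using log_ball_pos[OF x j] log_ball_pos[OF y j] T by (simp add: v_def log_mult log_divide)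
    show ?thesis unfolding plogp_def lv by (simp add: algebra_simps)
  qed
  then have "negent n v = (\<Sum>j\<le>n. v j * log 2 (x j) + v j * log 2 (y j) - v j * log 2 T)"
    unfolding negent_def by (intro sum.cong) auto
  also have "\<dots> = (\<Sum>j\<le>n. v j * log 2 (x j)) + (\<Sum>j\<le>n. v j * log 2 (y j)) - log 2 T"
    using simplex_mass[OF v]
    by (simp add: sum.distrib sum_subtractf mass_def flip: sum_distrib_right)
  also have "\<dots> \<le> negent n v - log 2 T"
    using log_ball_le[OF x v] log_ball_le[OF y v] g[OF v] by linarith
  finally have "log 2 T \<le> 0" by simp
  then show ?thesis using T unfolding T_def[symmetric] by simp
qed

definition polar_norm :: "nat \<Rightarrow> ((nat \<Rightarrow> real) \<Rightarrow> real) \<Rightarrow> (nat \<Rightarrow> real) \<Rightarrow> real"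
  where "polar_norm n g x = (SUP y\<in>log_ball n g. \<Sum>j\<le>n. \<bar>x j\<bar> * y j)"

lemma polar_norm_upper:
  assumes y: "y \<in> log_ball n g"
  shows "(\<Sum>j\<le>n. \<bar>x j\<bar> * y j) \<le> polar_norm n g x"
  unfolding polar_norm_def
proof (rule cSUP_upper[OF y])
  define e :: "nat \<Rightarrow> nat \<Rightarrow> real" where "e i = (\<lambda>j. if j = i then 1 else 0)" for i
  have "y j \<le> 2 powr g (e j)" if y: "y \<in> log_ball n g" and j: "j \<le> n" for y j
  proof -
    have "(\<Sum>i\<le>n. e j i * log 2 (y i)) = (\<Sum>i\<le>n. if i = j then log 2 (y j) else 0)"
      by (rule sum.cong) (auto simp: e_def)
    then have "log 2 (y j) \<le> g (e j)" using log_ball_le[OF y, of "e j"] j by (simp add: e_def)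
    then show ?thesis using log_ball_pos[OF y j] by (simp add: log_le_iff)
  qed
  then show "bdd_above ((\<lambda>y. \<Sum>j\<le>n. \<bar>x j\<bar> * y j) ` log_ball n g)"
    by (intro bdd_aboveI2[of _ _ "\<Sum>j\<le>n. \<bar>x j\<bar> * 2 powr g (e j)"] sum_mono mult_left_mono) auto
qed

lemma lattice_norm_polar_norm:
  assumes ne: "log_ball n g \<noteq> {}"
  shows "lattice_norm n (polar_norm n g)"
proof -
  let ?N = "polar_norm n g"
  have least: "?N x \<le> b" if "\<And>y. y \<in> log_ball n g \<Longrightarrow> (\<Sum>j\<le>n. \<bar>x j\<bar> * y j) \<le> b" for x b
    unfolding polar_norm_def by (rule cSUP_least[OF ne that])
  have def: "?N x = 0 \<longleftrightarrow> x = (\<lambda>i. 0)" if x: "x \<in> rvecs n" for x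
  proof
    assume N0: "?N x = 0"
    obtain y where y: "y \<in> log_ball n g" using ne by blast
    have nn: "\<And>j. 0 \<le> \<bar>x j\<bar> * y j" using log_ball_nonneg[OF y] by simp
    have "(\<Sum>j\<le>n. \<bar>x j\<bar> * y j) = 0"
      using polar_norm_upper[OF y, of x] N0 sum_nonneg[of "{..n}" "\<lambda>j. \<bar>x j\<bar> * y j"] nn by simp
    then have "\<forall>j\<in>{..n}. \<bar>x j\<bar> * y j = 0"
      using sum_nonneg_eq_0_iff[of "{..n}" "\<lambda>j. \<bar>x j\<bar> * y j"] nn by blast
    then have "x j = 0" if "j \<le> n" for j using log_ball_pos[OF y that] that by force
    then show "x = (\<lambda>i. 0)" using x by (auto simp: rvecs_iff fun_eq_iff not_le[symmetric])
  next
    assume "x = (\<lambda>i. 0)"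
    then show "?N x = 0" using ne by (simp add: polar_norm_def)
  qed
  have le: "?N (\<lambda>i. c * x i) \<le> \<bar>c\<bar> * ?N x" for c x
  proof (rule least)
    fix y assume y: "y \<in> log_ball n g"
    have "(\<Sum>j\<le>n. \<bar>c * x j\<bar> * y j) = \<bar>c\<bar> * (\<Sum>j\<le>n. \<bar>x j\<bar> * y j)"
      by (simp add: abs_mult sum_distrib_left mult.assoc)
    also have "\<dots> \<le> \<bar>c\<bar> * ?N x" by (intro mult_left_mono polar_norm_upper[OF y]) simp
    finally show "(\<Sum>j\<le>n. \<bar>c * x j\<bar> * y j) \<le> \<bar>c\<bar> * ?N x" .
  qed
  have hom: "?N (\<lambda>i. c * x i) = \<bar>c\<bar> * ?N x" for c x
  proof (cases "c = 0")
    case True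
    then show ?thesis using ne by (simp add: polar_norm_def)
  next
    case False
    then have "?N x \<le> \<bar>inverse c\<bar> * ?N (\<lambda>i. c * x i)"
      using le[of "inverse c" "\<lambda>i. c * x i"] by (simp add: mult.assoc[symmetric])
    then have "\<bar>c\<bar> * ?N x \<le> ?N (\<lambda>i. c * x i)" using False by (simp add: field_simps)
    then show ?thesis using le[of c x] by simp
  qed
  have tri: "?N (\<lambda>i. x i + x' i) \<le> ?N x + ?N x'" for x x'
  proof (rule least)
    fix y assume y: "y \<in> log_ball n g"
    have "(\<Sum>j\<le>n. \<bar>x j + x' j\<bar> * y j) \<le> (\<Sum>j\<le>n. \<bar>x j\<bar> * y j + \<bar>x' j\<bar> * y j)"
      unfolding distrib_right[symmetric]
      by (intro sum_mono mult_right_mono abs_triangle_ineq log_ball_nonneg[OF y])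
    then show "(\<Sum>j\<le>n. \<bar>x j + x' j\<bar> * y j) \<le> ?N x + ?N x'"
      using polar_norm_upper[OF y, of x] polar_norm_upper[OF y, of x'] by (simp add: sum.distrib)
  qed
  have mono: "?N x \<le> ?N x'" if xx: "\<forall>i\<le>n. \<bar>x i\<bar> \<le> \<bar>x' i\<bar>" for x x'
  proof (rule least)
    fix y assume y: "y \<in> log_ball n g"
    have "(\<Sum>j\<le>n. \<bar>x j\<bar> * y j) \<le> (\<Sum>j\<le>n. \<bar>x' j\<bar> * y j)"
      using xx by (intro sum_mono mult_right_mono log_ball_nonneg[OF y]) auto
    also have "\<dots> \<le> ?N x'" by (rule polar_norm_upper[OF y])
    finally show "(\<Sum>j\<le>n. \<bar>x j\<bar> * y j) \<le> ?N x'" .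
  qed
  show ?thesis unfolding lattice_norm_def using def hom tri mono by blast
qed

text \<open>
  Gibbs' inequality for \<open>t j = |x j| y j\<close>, in extended reals: if a coordinate of \<open>x\<close> vanishes where \<open>u\<close> does
  not, the left-hand side is \<open>-\<infinity>\<close>.
\<close>

lemma elog2_sum_le:
  assumes u: "u \<in> standard_simplex n" and y: "\<And>j. j \<le> n \<Longrightarrow> 0 < y j"
    and xy: "(\<Sum>j\<le>n. \<bar>x j\<bar> * y j) \<le> 1"
  shows "(\<Sum>i\<le>n. ereal (u i) * elog2 \<bar>x i\<bar>) \<le> ereal (negent n u - (\<Sum>j\<le>n. u j * log 2 (y j)))"
proof (cases "\<exists>j\<le>n. u j \<noteq> 0 \<and> x j = 0")
  case True
  then obtain k where k: "k \<le> n" "u k \<noteq> 0" "x k = 0" by blast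
  have np: "ereal (u i) * elog2 \<bar>x i\<bar> \<noteq> \<infinity>" for i
    using simplex_nonneg[OF u, of i] by (auto simp: elog2_def)
  have "ereal (u k) * elog2 \<bar>x k\<bar> = - \<infinity>"
    using simplex_nonneg[OF u, of k] k by (simp add: elog2_def)
  moreover have "(\<Sum>i\<in>{..n} - {k}. ereal (u i) * elog2 \<bar>x i\<bar>) \<noteq> \<infinity>"
    using np by (simp add: sum_Pinfty)
  ultimately have "(\<Sum>i\<le>n. ereal (u i) * elog2 \<bar>x i\<bar>) = - \<infinity>"
    using k(1) by (simp only: sum.remove[of "{..n}" k] finite_atMost atMost_iff) simp
  then show ?thesis by simp
next
  case False
  have "(\<Sum>i\<le>n. ereal (u i) * elog2 \<bar>x i\<bar>) = (\<Sum>i\<le>n. ereal (u i * log 2 \<bar>x i\<bar>))"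
    by (rule sum.cong) (use False in \<open>auto simp: elog2_def\<close>)
  also have "\<dots> = ereal (\<Sum>i\<le>n. u i * log 2 \<bar>x i\<bar>)" by (rule sum_ereal)
  also have "(\<Sum>i\<le>n. u i * log 2 \<bar>x i\<bar>) = (\<Sum>i\<le>n. u i * log 2 (\<bar>x i\<bar> * y i) - u i * log 2 (y i))"
  proof (rule sum.cong[OF refl])
    fix i assume "i \<in> {..n}"
    then have i: "i \<le> n" by simp
    show "u i * log 2 \<bar>x i\<bar> = u i * log 2 (\<bar>x i\<bar> * y i) - u i * log 2 (y i)"
    proof (cases "u i = 0")
      case F: False
      then have "x i \<noteq> 0" using False i by blast
      then show ?thesis using y[OF i] by (simp add: log_mult algebra_simps)
    qed simp
  qed
  also have "\<dots> = (\<Sum>i\<le>n. u i * log 2 (\<bar>x i\<bar> * y i)) - (\<Sum>j\<le>n. u j * log 2 (y j))"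
    by (rule sum_subtractf)
  also have "ereal \<dots> \<le> ereal (negent n u - (\<Sum>j\<le>n. u j * log 2 (y j)))"
  proof -
    have "(\<Sum>i\<le>n. u i * log 2 (\<bar>x i\<bar> * y i)) \<le> negent n u"
      by (rule gibbs[OF u _ _ xy]) (use y False in \<open>force+\<close>)
    then show ?thesis by simp
  qed
  finally show ?thesis .
qed

text \<open>
  An element of the unit ball that nearly attains \<open>g1 u\<close> gives the lower bound. An element \<open>y\<close> of the second
  ball that nearly attains \<open>g2 u\<close> gives the upper bound, because Gibbs' inequality limits
  \<open>\<Sum> u_j log_2 |x_j|\<close> by \<open>\<Lambda>(u) - \<Sum> u_j log_2 y_j\<close>, which is nearly \<open>\<Lambda>(u) - g2 u = g1 u\<close>. The assumptions
  are symmetric enough to apply to a norm and, with \<open>g1\<close> and \<open>g2\<close> exchanged, to its dual.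
\<close>

lemma indicator_between:
  assumes g: "\<And>u. u \<in> standard_simplex n \<Longrightarrow> g1 u + g2 u = negent n u"
    and s1: "supportable n K g1" and s2: "supportable n K g2" and u: "u \<in> standard_simplex n"
    and sub: "\<And>x. x \<in> log_ball n g1 \<Longrightarrow> N x \<le> 1"
    and sup: "\<And>x y. x \<in> rvecs n \<Longrightarrow> N x \<le> 1 \<Longrightarrow> y \<in> log_ball n g2 \<Longrightarrow> (\<Sum>j\<le>n. \<bar>x j\<bar> * y j) \<le> 1"
  shows "ereal (g1 u - K) \<le> lattice_indicator n N u" "lattice_indicator n N u \<le> ereal (g1 u + K)"
proof -
  obtain x where x: "x \<in> log_ball n g1" "g1 u - K \<le> (\<Sum>j\<le>n. u j * log 2 (x j))"
    by (rule supportable_log_ball[OF s1 u])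
  have "(\<Sum>i\<le>n. ereal (u i) * elog2 \<bar>x i\<bar>) = (\<Sum>i\<le>n. ereal (u i * log 2 (x i)))"
    by (rule sum.cong) (use log_ball_pos[OF x(1)] in \<open>force simp: elog2_def\<close>)+
  then have "ereal (g1 u - K) \<le> (\<Sum>i\<le>n. ereal (u i) * elog2 \<bar>x i\<bar>)" using x(2) by simp
  also have "\<dots> \<le> lattice_indicator n N u"
    unfolding lattice_indicator_def
    by (rule SUP_upper) (use log_ball_rvecs[OF x(1)] sub[OF x(1)] in auto)
  finally show "ereal (g1 u - K) \<le> lattice_indicator n N u" .
  obtain y where y: "y \<in> log_ball n g2" "g2 u - K \<le> (\<Sum>j\<le>n. u j * log 2 (y j))"
    by (rule supportable_log_ball[OF s2 u])
  show "lattice_indicator n N u \<le> ereal (g1 u + K)"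
    unfolding lattice_indicator_def
  proof (rule SUP_least)
    fix x assume "x \<in> {x \<in> rvecs n. N x \<le> 1}"
    then have xy: "(\<Sum>j\<le>n. \<bar>x j\<bar> * y j) \<le> 1" using sup y(1) by blast
    have "(\<Sum>i\<le>n. ereal (u i) * elog2 \<bar>x i\<bar>) \<le> ereal (negent n u - (\<Sum>j\<le>n. u j * log 2 (y j)))"
      by (rule elog2_sum_le[OF u _ xy]) (rule log_ball_pos[OF y(1)])
    also have "\<dots> \<le> ereal (g1 u + K)" using y(2) g[OF u] by simp
    finally show "(\<Sum>i\<le>n. ereal (u i) * elog2 \<bar>x i\<bar>) \<le> ereal (g1 u + K)" .
  qed
qed

text \<open>
  The norm is \<open>polar_norm n g2\<close>. By \<open>log_ball_pairing\<close> its unit ball contains the ball of \<open>g1\<close>, and by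
  construction the dual unit ball contains the ball of \<open>g2\<close>, so \<open>indicator_between\<close> applies to both
  norms.
\<close>

lemma lattice_norm_from_supportable:
  assumes g: "\<And>u. u \<in> standard_simplex n \<Longrightarrow> g1 u + g2 u = negent n u"
    and s1: "supportable n K g1" and s2: "supportable n K g2"
  obtains N where "lattice_norm n N"
    "\<And>u. u \<in> standard_simplex n \<Longrightarrow> ereal (g1 u - K) \<le> lattice_indicator n N u"
    "\<And>u. u \<in> standard_simplex n \<Longrightarrow> lattice_indicator n N u \<le> ereal (g1 u + K)"
    "\<And>u. u \<in> standard_simplex n \<Longrightarrow> ereal (g2 u - K) \<le> lattice_indicator n (dual_norm n N) u"
    "\<And>u. u \<in> standard_simplex n \<Longrightarrow> lattice_indicator n (dual_norm n N) u \<le> ereal (g2 u + K)"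
proof -
  define N where "N = polar_norm n g2"
  obtain u0 where "u0 \<in> standard_simplex n" using nonempty_standard_simplex by blast
  then have ne: "log_ball n g2 \<noteq> {}" using supportable_log_ball[OF s2] by blast
  have N: "lattice_norm n N" unfolding N_def by (rule lattice_norm_polar_norm[OF ne])
  have g': "g2 u + g1 u = negent n u" if "u \<in> standard_simplex n" for u using g[OF that] by simp
  have abs_eq: "(\<Sum>j\<le>n. \<bar>x j\<bar> * y j) = (\<Sum>j\<le>n. x j * y j)" if "x \<in> log_ball n g1" for x y
    using log_ball_nonneg[OF that] by simp
  have sub: "N x \<le> 1" if x: "x \<in> log_ball n g1" for x
    unfolding N_def polar_norm_def
    by (rule cSUP_least[OF ne]) (use log_ball_pairing[OF g x] abs_eq[OF x] in simp)
  have sup: "(\<Sum>j\<le>n. \<bar>x j\<bar> * y j) \<le> 1" if "N x \<le> 1" "y \<in> log_ball n g2" for x y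
    using polar_norm_upper[OF that(2), of x] that(1) unfolding N_def by simp
  have z: "(\<lambda>i. 0) \<in> {x \<in> rvecs n. N x \<le> 1}"
    using lattice_norm_eq_0[OF N, of "\<lambda>i. 0"] by (simp add: rvecs_iff)
  have dsub: "dual_norm n N y \<le> 1" if y: "y \<in> log_ball n g2" for y
    unfolding dual_norm_def
  proof (rule cSUP_least)
    fix x assume "x \<in> {x \<in> rvecs n. N x \<le> 1}"
    then have "(\<Sum>j\<le>n. \<bar>x j\<bar> * y j) \<le> 1" using sup y by simp
    moreover have "\<bar>\<Sum>i\<le>n. y i * x i\<bar> \<le> (\<Sum>i\<le>n. \<bar>y i * x i\<bar>)" by (rule sum_abs)
    moreover have "(\<Sum>i\<le>n. \<bar>y i * x i\<bar>) = (\<Sum>j\<le>n. \<bar>x j\<bar> * y j)"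
      using log_ball_nonneg[OF y] by (simp add: abs_mult mult.commute)
    ultimately show "\<bar>\<Sum>i\<le>n. y i * x i\<bar> \<le> 1" by simp
  qed (use z in blast)
  have dsup: "(\<Sum>j\<le>n. \<bar>y j\<bar> * x j) \<le> 1"
    if y: "y \<in> rvecs n" "dual_norm n N y \<le> 1" and x: "x \<in> log_ball n g1" for x y
  proof -
    \<comment> \<open>Choose the signs of \<open>x\<close> so that the pairing with \<open>y\<close> has no cancellation.\<close>
    define x' where "x' j = sgn (y j) * x j" for j
    have x'r: "x' \<in> rvecs n" using log_ball_rvecs[OF x] by (auto simp: x'_def rvecs_iff)
    have "N x' \<le> N x"
      by (rule lattice_norm_mono[OF N x'r log_ball_rvecs[OF x]]) (auto simp: x'_def abs_mult sgn_if)
    then have "x' \<in> {x \<in> rvecs n. N x \<le> 1}" using x'r sub[OF x] by simp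
    then have "\<bar>\<Sum>i\<le>n. y i * x' i\<bar> \<le> dual_norm n N y"
      unfolding dual_norm_def by (rule cSUP_upper[OF _ bdd_above_dual_norm[OF N]])
    moreover have "(\<Sum>i\<le>n. y i * x' i) = (\<Sum>j\<le>n. \<bar>y j\<bar> * x j)"
      by (rule sum.cong) (auto simp: x'_def abs_if sgn_if)
    ultimately show ?thesis using y(2) by linarith
  qed
  show thesis
  proof (rule that[OF N])
    fix u assume u: "u \<in> standard_simplex n"
    show "ereal (g1 u - K) \<le> lattice_indicator n N u" "lattice_indicator n N u \<le> ereal (g1 u + K)"
      by (rule indicator_between[of n g1 g2 K u N]; use g s1 s2 u sub sup in blast)+
    show "ereal (g2 u - K) \<le> lattice_indicator n (dual_norm n N) u"
      "lattice_indicator n (dual_norm n N) u \<le> ereal (g2 u + K)"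
      by (rule indicator_between[of n g2 g1 K u "dual_norm n N"]; use g' s1 s2 u dsub dsup in blast)+
  qed
qed

section \<open>The approximation theorem\<close>

lemma omega2_midpoint_affine:
  assumes "omega2 n f \<le> ereal (1 - e)"
  shows "midpoint_affine n ((1 - e) / 2) f"
  unfolding midpoint_affine_def
proof (intro ballI)
  have *: "\<bar>b - (a + c) / 2\<bar> \<le> (1 - e) / 2" if "\<bar>a - 2 * b + c\<bar> \<le> 1 - e" for a b c
  proof -
    have eq: "b - (a + c) / 2 = - (a - 2 * b + c) / 2" by (simp add: field_simps)
    show ?thesis unfolding eq abs_divide abs_minus_cancel using that by simp
  qed
  fix x y assume x: "x \<in> standard_simplex n" and y: "y \<in> standard_simplex n"
  define h where "h = (\<lambda>j. (y j - x j) / 2)"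
  have mid: "(\<lambda>i. x i + h i) = (\<lambda>j. (x j + y j) / 2)" and fin: "(\<lambda>i. x i + 2 * h i) = y"
    by (auto simp: h_def field_simps)
  have "(\<lambda>j. (x j + y j) / 2) \<in> standard_simplex n"
    using simplex_segment[OF x y, of "1/2"] by (simp add: add_divide_distrib)
  moreover have "x \<in> rvecs n" "h \<in> rvecs n"
    using simplex_beyond[OF x] simplex_beyond[OF y] by (auto simp: rvecs_iff h_def)
  ultimately have "ereal \<bar>f x - 2 * f (\<lambda>i. x i + h i) + f (\<lambda>i. x i + 2 * h i)\<bar> \<le> omega2 n f"
    unfolding omega2_def using x y mid fin
    by (intro SUP_upper2[of "(x, h)"]) auto
  also note assms
  finally have "\<bar>f x - 2 * f (\<lambda>j. (x j + y j) / 2) + f y\<bar> \<le> 1 - e" by (simp add: mid fin)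
  then show "\<bar>f (\<lambda>j. (x j + y j) / 2) - (f x + f y) / 2\<bar> \<le> (1 - e) / 2"
    using *[of "f x" "f (\<lambda>j. (x j + y j) / 2)" "f y"] by blast
qed

lemma continuous_on_simplex_bounded:
  assumes "continuous_on_simplex n f"
  obtains B where "\<And>x. x \<in> standard_simplex n \<Longrightarrow> \<bar>f x\<bar> \<le> B"
proof -
  have sub: "standard_simplex n \<subseteq> rvecs n" using simplex_beyond by (auto simp: rvecs_iff)
  have "compactin (subtopology (Euclidean_space (Suc n)) (standard_simplex n)) (standard_simplex n)"
    using sub compactin_standard_simplex[of n]
    by (auto simp: Euclidean_space_def compactin_subtopology)
  from image_compactin[OF this assms] have "bounded (f ` standard_simplex n)"
    by (simp add: compact_imp_bounded)
  then show thesis using that by (auto simp: bounded_iff)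
qed

theorem theorem3p7:
  fixes \<epsilon> :: real
  assumes "0 < \<epsilon>" and "\<epsilon> < 1 / 2"
  shows "\<exists>C::real. \<forall>(n::nat) (f :: (nat \<Rightarrow> real) \<Rightarrow> real).
    continuous_on_simplex n f \<and> omega2 n f \<le> ereal (1 - \<epsilon>) \<longrightarrow>
    (\<exists>N. lattice_norm n N \<and>
      (\<forall>u\<in>standard_simplex n.
        \<bar>ereal (f u) - ereal (1 / 2) *
            (lattice_indicator n N u - lattice_indicator n (dual_norm n N) u)\<bar> \<le> ereal C))"
proof -
  obtain D where D: "0 \<le> D" "\<And>n f B. midpoint_affine n ((1 - \<epsilon>) / 2) f \<Longrightarrow>
     (\<And>x. x \<in> standard_simplex n \<Longrightarrow> \<bar>f x\<bar> \<le> B) \<Longrightarrow> info_affine n f D"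
    by (rule uniform_info_affine[of \<epsilon>]) (use assms in auto)
  show ?thesis
  proof (intro exI[of _ "D + 3/2"] allI impI, elim conjE)
    fix n and f :: "(nat \<Rightarrow> real) \<Rightarrow> real"
    assume cont: "continuous_on_simplex n f" and om: "omega2 n f \<le> ereal (1 - \<epsilon>)"
    obtain B where B: "\<And>x. x \<in> standard_simplex n \<Longrightarrow> \<bar>f x\<bar> \<le> B"
      using continuous_on_simplex_bounded[OF cont] by blast
    have mid: "midpoint_affine n ((1 - \<epsilon>) / 2) f" by (rule omega2_midpoint_affine[OF om])
    note neg = midpoint_affine_uminus
    have half: "midpoint_affine n (1/2) f"
      by (rule midpoint_affine_mono[OF mid]) (use assms in simp)
    define g1 g2 where "g1 = (\<lambda>u. f u + negent n u / 2)" and "g2 = (\<lambda>u. - f u + negent n u / 2)"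
    have "supportable n (D + 3/2) g1"
      unfolding g1_def by (rule supportable_add_half_negent[OF half B D(2)[OF mid B] D(1)])
    moreover have "supportable n (D + 3/2) g2"
      unfolding g2_def
      by (rule supportable_add_half_negent[OF neg[OF half] _ D(2)[OF neg[OF mid]] D(1)]) (use B in auto)
    moreover have "g1 u + g2 u = negent n u" for u by (simp add: g1_def g2_def)
    ultimately obtain N where N: "lattice_norm n N"
      and bd: "\<And>u. u \<in> standard_simplex n \<Longrightarrow> ereal (g1 u - (D + 3/2)) \<le> lattice_indicator n N u"
        "\<And>u. u \<in> standard_simplex n \<Longrightarrow> lattice_indicator n N u \<le> ereal (g1 u + (D + 3/2))"
        "\<And>u. u \<in> standard_simplex n \<Longrightarrow> ereal (g2 u - (D + 3/2)) \<le> lattice_indicator n (dual_norm n N) u"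
        "\<And>u. u \<in> standard_simplex n \<Longrightarrow> lattice_indicator n (dual_norm n N) u \<le> ereal (g2 u + (D + 3/2))"
      using lattice_norm_from_supportable by blast
    show "\<exists>N. lattice_norm n N \<and>
      (\<forall>u\<in>standard_simplex n.
        \<bar>ereal (f u) - ereal (1 / 2) *
            (lattice_indicator n N u - lattice_indicator n (dual_norm n N) u)\<bar> \<le> ereal (D + 3/2))"
    proof (intro exI[of _ N] conjI N ballI)
      fix u assume u: "u \<in> standard_simplex n"
      obtain a where a: "lattice_indicator n N u = ereal a"
        using bd(1,2)[OF u] by (cases "lattice_indicator n N u") auto
      obtain b where b: "lattice_indicator n (dual_norm n N) u = ereal b"
        using bd(3,4)[OF u] by (cases "lattice_indicator n (dual_norm n N) u") auto
      have "\<bar>a - g1 u\<bar> \<le> D + 3/2" "\<bar>b - g2 u\<bar> \<le> D + 3/2"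
        using bd[OF u] by (auto simp: a b abs_le_iff)
      then have "\<bar>(b - g2 u) - (a - g1 u)\<bar> \<le> 2 * (D + 3/2)"
        using abs_triangle_ineq4[of "b - g2 u" "a - g1 u"] by argo
      then have "\<bar>(b - g2 u) - (a - g1 u)\<bar> / 2 \<le> D + 3/2" by simp
      moreover have eq: "f u - 1/2 * (a - b) = ((b - g2 u) - (a - g1 u)) / 2"
        by (simp add: g1_def g2_def field_simps)
      ultimately have "\<bar>f u - 1/2 * (a - b)\<bar> \<le> D + 3/2" unfolding eq by simp
      then show "\<bar>ereal (f u) - ereal (1 / 2) *
            (lattice_indicator n N u - lattice_indicator n (dual_norm n N) u)\<bar> \<le> ereal (D + 3/2)"
        by (simp add: a b)
    qed
  qed
qed

end
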